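(* Let $\mathcal{M}$ be a class of $\Sigma$-Nmatrices such that $\Vdash=\Vdash_{\mathcal{M}}$ is compact. Then $\mathsf{Nmatr}(\Vdash)=\mathsf{Hom}_s^{\Vdash}(\mathsf{Hom}^{-1}_s(\mathsf{S}(\mathsf{P}_{\mathcal{U}}(\mathcal{M}))))$.
   Context: Fix a countable signature $\Sigma$ (sets $\Sigma^k$ of $k$-ary connectives), a denumerable set $P$ of variables and the set $Fm$ of formulas. A $\Sigma$-Nmatrix is $\mathbb{M}=\langle A,\cdot_{\mathbb{M}},D\rangle$, each $\copyright\in\Sigma^k$ interpreted as $\copyright_{\mathbb{M}}:A^k\to\wp(A)\setminus\{\emptyset\}$, $D\subseteq A$. A valuation is $v:Fm\to A$ with $v(\copyright(\varphi_1,\dots,\varphi_k))\in\copyright_{\mathbb{M}}(v(\varphi_1),\dots,v(\varphi_k))$. $\Gamma\Vdash_{\mathbb{M}}\Delta$ iff every valuation $v$ with $v[\Gamma]\subseteq D$ has $v[\Delta]\cap D\neq\emptyset$; $\Vdash_{\mathcal{M}}=\bigcap_{\mathbb{M}\in\mathcal{M}}\Vdash_{\mathbb{M}}$. A relation $\Vdash$ is compact if whenever $\Gamma\Vdash\Delta$ there are finite $\Gamma_0\subseteq\Gamma$, $\Delta_0\subseteq\Delta$ with $\Gamma_0\Vdash\Delta_0$. An Nmatrix $\mathbb{N}$ is $\Vdash$-sound if $\Vdash\subseteq\Vdash_{\mathbb{N}}$; $\mathsf{Nmatr}(\Vdash)$ is the class of $\Vdash$-sound $\Sigma$-Nmatrices.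 For $\mathbb{M}_1=\langle A_1,\cdot_1,D_1\rangle$, $\mathbb{M}_2=\langle A_2,\cdot_2,D_2\rangle$, a homomorphism $h:\mathbb{M}_1\to\mathbb{M}_2$ is a map $h:A_1\to A_2$ with $h[\copyright_1(a_1,\dots,a_k)]\subseteq\copyright_2(h(a_1),\dots,h(a_k))$ and $h[D_1]\subseteq D_2$; strict if $h^{-1}[D_2]=D_1$. An isomorphism is a bijective strict homomorphism with $h[\copyright_1(\vec x)]=\copyright_2(h(\vec x))$. The image $h[\mathbb{M}_1]=\langle h[A_1],\cdot_h,D_2\cap h[A_1]\rangle$ with $\copyright_h(x_1,\dots,x_k)=\{h(y):y\in\copyright_1(y_1,\dots,y_k),\ h(y_j)=x_j\}$; $h$ is covering if $h[\mathbb{M}_1]=\mathbb{M}_2$. $\mathbb{M}_1$ is a subNmatrix of $\mathbb{M}_2$ if $A_1\subseteq A_2$ and $\copyright_1(\vec x)\subseteq\copyright_2(\vec x)$ for $\vec x\in A_1^k$. The quotient of $\langle A,\cdot,D\rangle$ by an equivalence $\equiv$ is $\langle A/{\equiv},\cdot_\equiv,\{[x]:x\in D\}\rangle$ with $\copyright_\equiv([x_1],\dots,[x_k])=\{[y]:y\in\copyright(y_1,\dots,y_k),\ y_j\equiv x_j\}$; $\equiv$ is compatible if $x\equiv y$ implies ($x\in D$ iff $y\in D$). The product of $\mathbb{M}_i=\langle A_i,\cdot_i,D_i\rangle$, $i\in I$, is $\langle\Pi A_i,\cdot_I,\Pi D_i\rangle$ with $\copyright_I(s_1,\dots,s_k)=\Pi_i\copyright_i(\pi_i(s_1),\dots,\pi_i(s_k))$;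 for an ultrafilter $\mathcal{U}$ on $I$, $s\equiv_{\mathcal{U}}t$ iff $\{i:\pi_i(s)=\pi_i(t)\}\in\mathcal{U}$, and the ultraproduct $\Pi_{\mathcal{U}}\mathbb{M}_i$ is the quotient of the product by $\equiv_{\mathcal{U}}$. Class operators, for a class $\mathcal{K}$: $\mathsf{S}(\mathcal{K})$ = isomorphic copies of subNmatrices of members of $\mathcal{K}$; $\mathsf{Hom}^{-1}_s(\mathcal{K})$ = isomorphic copies of Nmatrices admitting a covering strict homomorphism onto a member of $\mathcal{K}$; $\mathsf{Hom}_s^{\Vdash}(\mathcal{K})$ = isomorphic copies of $\Vdash$-sound quotients $\mathbb{N}/{\equiv}$ with $\mathbb{N}\in\mathcal{K}$ and $\equiv$ compatible; $\mathsf{P}_{\mathcal{U}}(\mathcal{K})$ = isomorphic copies of ultraproducts (over arbitrary index sets and ultrafilters) of families of members of $\mathcal{K}$.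
   Formalization: The equation is stated for signatures without nullary connectives (it fails for multi-valued constants); in general, the right side is contained in Nmatr(⊩), and every ⊩-sound Nmatrix whose nullary connectives are single-valued lies in it. Nmatrices have non-empty carriers. *)

theory Defs
  imports "HOL-Library.FuncSet" "HOL-Library.Countable_Set" "HOL-Library.Equipollence"
begin

section \<open>Formulas and consequence relations\<close>

text \<open>A signature is a family \<open>Sg :: nat \<Rightarrow> 's set\<close>, \<open>Sg k\<close> being the set of \<open>k\<close>-ary connectives.
  Tuples are lists, so an occurrence of a connective determines the arity at which it is used.\<close>

datatype ('s, 'p) fm = Var 'p | Con 's "('s, 'p) fm list"

inductive_set Fm :: "(nat \<Rightarrow> 's set) \<Rightarrow> 'p set \<Rightarrow> ('s, 'p) fm set"
  for Sg :: "nat \<Rightarrow> 's set" and P :: "'p set" where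
  Var: "p \<in> P \<Longrightarrow> Var p \<in> Fm Sg P"
| Con: "c \<in> Sg (length \<phi>s) \<Longrightarrow> (\<And>\<phi>. \<phi> \<in> set \<phi>s \<Longrightarrow> \<phi> \<in> Fm Sg P) \<Longrightarrow> Con c \<phi>s \<in> Fm Sg P"

type_synonym ('s, 'p) conseq = "(('s, 'p) fm set \<times> ('s, 'p) fm set) set"

definition compact_conseq :: "('s, 'p) conseq \<Rightarrow> bool" where
  "compact_conseq R \<longleftrightarrow>
     (\<forall>\<Gamma> \<Delta>. (\<Gamma>, \<Delta>) \<in> R \<longrightarrow>
        (\<exists>\<Gamma>0 \<Delta>0. finite \<Gamma>0 \<and> finite \<Delta>0 \<and> \<Gamma>0 \<subseteq> \<Gamma> \<and> \<Delta>0 \<subseteq> \<Delta> \<and> (\<Gamma>0, \<Delta>0) \<in> R))"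

section \<open>Nmatrices\<close>

text \<open>Only the values of \<open>interp\<close> on connectives of the signature and tuples of the right length
  over \<open>vals\<close> are meaningful; two records that differ elsewhere are the same Nmatrix.\<close>

record ('s, 'a) nmatrix =
  vals :: "'a set"
  interp :: "'s \<Rightarrow> 'a list \<Rightarrow> 'a set"
  desig :: "'a set"

definition tuples :: "nat \<Rightarrow> 'a set \<Rightarrow> 'a list set" where
  "tuples k A = {xs. length xs = k \<and> set xs \<subseteq> A}"

definition is_nmatrix :: "(nat \<Rightarrow> 's set) \<Rightarrow> ('s, 'a) nmatrix \<Rightarrow> bool" where
  "is_nmatrix Sg M \<longleftrightarrow>
     vals M \<noteq> {} \<and> desig M \<subseteq> vals M \<and>
     (\<forall>k. \<forall>c \<in> Sg k. \<forall>xs \<in> tuples k (vals M). interp M c xs \<subseteq> vals M \<and> interp M c xs \<noteq> {})"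

definition same_nmatrix :: "(nat \<Rightarrow> 's set) \<Rightarrow> ('s, 'a) nmatrix \<Rightarrow> ('s, 'a) nmatrix \<Rightarrow> bool" where
  "same_nmatrix Sg M N \<longleftrightarrow>
     vals M = vals N \<and> desig M = desig N \<and>
     (\<forall>k. \<forall>c \<in> Sg k. \<forall>xs \<in> tuples k (vals M). interp M c xs = interp N c xs)"

definition valuation ::
  "(nat \<Rightarrow> 's set) \<Rightarrow> 'p set \<Rightarrow> ('s, 'a) nmatrix \<Rightarrow> (('s, 'p) fm \<Rightarrow> 'a) \<Rightarrow> bool" where
  "valuation Sg P M v \<longleftrightarrow>
     (\<forall>\<phi> \<in> Fm Sg P. v \<phi> \<in> vals M) \<and>
     (\<forall>k. \<forall>c \<in> Sg k. \<forall>\<phi>s \<in> tuples k (Fm Sg P). v (Con c \<phi>s) \<in> interp M c (map v \<phi>s))"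

definition entails :: "(nat \<Rightarrow> 's set) \<Rightarrow> 'p set \<Rightarrow> ('s, 'a) nmatrix \<Rightarrow> ('s, 'p) conseq" where
  "entails Sg P M =
     {(\<Gamma>, \<Delta>). \<Gamma> \<subseteq> Fm Sg P \<and> \<Delta> \<subseteq> Fm Sg P \<and>
        (\<forall>v. valuation Sg P M v \<longrightarrow> v ` \<Gamma> \<subseteq> desig M \<longrightarrow> v ` \<Delta> \<inter> desig M \<noteq> {})}"

definition entails_class ::
  "(nat \<Rightarrow> 's set) \<Rightarrow> 'p set \<Rightarrow> ('s, 'a) nmatrix set \<Rightarrow> ('s, 'p) conseq" where
  "entails_class Sg P \<M> =
     {(\<Gamma>, \<Delta>). \<Gamma> \<subseteq> Fm Sg P \<and> \<Delta> \<subseteq> Fm Sg P \<and> (\<forall>M \<in> \<M>. (\<Gamma>, \<Delta>) \<in> entails Sg P M)}"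

definition sound ::
  "(nat \<Rightarrow> 's set) \<Rightarrow> 'p set \<Rightarrow> ('s, 'p) conseq \<Rightarrow> ('s, 'a) nmatrix \<Rightarrow> bool" where
  "sound Sg P R N \<longleftrightarrow> R \<subseteq> entails Sg P N"

definition Nmatr ::
  "(nat \<Rightarrow> 's set) \<Rightarrow> 'p set \<Rightarrow> ('s, 'p) conseq \<Rightarrow> ('s, 'a) nmatrix set" where
  "Nmatr Sg P R = {N. is_nmatrix Sg N \<and> sound Sg P R N}"

section \<open>Homomorphisms\<close>

definition is_hom ::
  "(nat \<Rightarrow> 's set) \<Rightarrow> ('a \<Rightarrow> 'b) \<Rightarrow> ('s, 'a) nmatrix \<Rightarrow> ('s, 'b) nmatrix \<Rightarrow> bool" where
  "is_hom Sg h M N \<longleftrightarrow>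
     h ` vals M \<subseteq> vals N \<and>
     (\<forall>k. \<forall>c \<in> Sg k. \<forall>xs \<in> tuples k (vals M). h ` interp M c xs \<subseteq> interp N c (map h xs)) \<and>
     h ` desig M \<subseteq> desig N"

definition strict_hom ::
  "(nat \<Rightarrow> 's set) \<Rightarrow> ('a \<Rightarrow> 'b) \<Rightarrow> ('s, 'a) nmatrix \<Rightarrow> ('s, 'b) nmatrix \<Rightarrow> bool" where
  "strict_hom Sg h M N \<longleftrightarrow> is_hom Sg h M N \<and> h -` desig N \<inter> vals M = desig M"

definition is_iso ::
  "(nat \<Rightarrow> 's set) \<Rightarrow> ('a \<Rightarrow> 'b) \<Rightarrow> ('s, 'a) nmatrix \<Rightarrow> ('s, 'b) nmatrix \<Rightarrow> bool" where
  "is_iso Sg h M N \<longleftrightarrow>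
     strict_hom Sg h M N \<and> bij_betw h (vals M) (vals N) \<and>
     (\<forall>k. \<forall>c \<in> Sg k. \<forall>xs \<in> tuples k (vals M). h ` interp M c xs = interp N c (map h xs))"

definition isomorphic ::
  "(nat \<Rightarrow> 's set) \<Rightarrow> ('s, 'a) nmatrix \<Rightarrow> ('s, 'b) nmatrix \<Rightarrow> bool" where
  "isomorphic Sg M N \<longleftrightarrow> (\<exists>h. is_iso Sg h M N)"

definition image_nmatrix ::
  "('a \<Rightarrow> 'b) \<Rightarrow> ('s, 'a) nmatrix \<Rightarrow> ('s, 'b) nmatrix \<Rightarrow> ('s, 'b) nmatrix" where
  "image_nmatrix h M N =
     \<lparr>vals = h ` vals M,
      interp = (\<lambda>c xs. {h y | y ys. set ys \<subseteq> vals M \<and> map h ys = xs \<and> y \<in> interp M c ys}),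
      desig = desig N \<inter> h ` vals M\<rparr>"

definition covering ::
  "(nat \<Rightarrow> 's set) \<Rightarrow> ('a \<Rightarrow> 'b) \<Rightarrow> ('s, 'a) nmatrix \<Rightarrow> ('s, 'b) nmatrix \<Rightarrow> bool" where
  "covering Sg h M N \<longleftrightarrow> same_nmatrix Sg (image_nmatrix h M N) N"

section \<open>SubNmatrices, quotients, products and ultraproducts\<close>

text \<open>As for submatrices, the designated values of a subNmatrix are the inherited ones.\<close>

definition subnmatrix ::
  "(nat \<Rightarrow> 's set) \<Rightarrow> ('s, 'a) nmatrix \<Rightarrow> ('s, 'a) nmatrix \<Rightarrow> bool" where
  "subnmatrix Sg M N \<longleftrightarrow>
     is_nmatrix Sg M \<and> vals M \<subseteq> vals N \<and> desig M = desig N \<inter> vals M \<and>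
     (\<forall>k. \<forall>c \<in> Sg k. \<forall>xs \<in> tuples k (vals M). interp M c xs \<subseteq> interp N c xs)"

definition compatible :: "('s, 'a) nmatrix \<Rightarrow> ('a \<times> 'a) set \<Rightarrow> bool" where
  "compatible M r \<longleftrightarrow> (\<forall>(x, y) \<in> r. x \<in> desig M \<longleftrightarrow> y \<in> desig M)"

definition quot :: "('s, 'a) nmatrix \<Rightarrow> ('a \<times> 'a) set \<Rightarrow> ('s, 'a set) nmatrix" where
  "quot M r =
     \<lparr>vals = vals M // r,
      interp = (\<lambda>c Xs. {r `` {y} | y ys. list_all2 (\<in>) ys Xs \<and> y \<in> interp M c ys}),
      desig = {r `` {x} | x. x \<in> desig M}\<rparr>"

definition product :: "'i set \<Rightarrow> ('i \<Rightarrow> ('s, 'a) nmatrix) \<Rightarrow> ('s, 'i \<Rightarrow> 'a) nmatrix" where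
  "product I F =
     \<lparr>vals = (\<Pi>\<^sub>E i\<in>I. vals (F i)),
      interp = (\<lambda>c ss. \<Pi>\<^sub>E i\<in>I. interp (F i) c (map (\<lambda>s. s i) ss)),
      desig = (\<Pi>\<^sub>E i\<in>I. desig (F i))\<rparr>"

definition ultrafilter_on :: "'i set \<Rightarrow> 'i set set \<Rightarrow> bool" where
  "ultrafilter_on I U \<longleftrightarrow>
     U \<subseteq> Pow I \<and> I \<in> U \<and> {} \<notin> U \<and>
     (\<forall>X \<in> U. \<forall>Y \<in> U. X \<inter> Y \<in> U) \<and>
     (\<forall>X \<in> U. \<forall>Y. X \<subseteq> Y \<and> Y \<subseteq> I \<longrightarrow> Y \<in> U) \<and>
     (\<forall>X. X \<subseteq> I \<longrightarrow> X \<in> U \<or> I - X \<in> U)"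

definition ultra_eq ::
  "'i set \<Rightarrow> 'i set set \<Rightarrow> ('i \<Rightarrow> ('s, 'a) nmatrix) \<Rightarrow> (('i \<Rightarrow> 'a) \<times> ('i \<Rightarrow> 'a)) set" where
  "ultra_eq I U F =
     {(s, t). s \<in> vals (product I F) \<and> t \<in> vals (product I F) \<and> {i \<in> I. s i = t i} \<in> U}"

definition ultraproduct ::
  "'i set \<Rightarrow> 'i set set \<Rightarrow> ('i \<Rightarrow> ('s, 'a) nmatrix) \<Rightarrow> ('s, ('i \<Rightarrow> 'a) set) nmatrix" where
  "ultraproduct I U F = quot (product I F) (ultra_eq I U F)"

section \<open>Class operators\<close>

text \<open>A class of Nmatrices is represented by the set of its members whose values are taken from a
  given type. Operators that change the size of the set of values lead from one such type to
  another; isomorphic copies are what makes the choice of the type immaterial, as long as it is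
  large enough. The type \<open>'i\<close> supplies the index sets of the ultraproducts.\<close>

definition SubN ::
  "(nat \<Rightarrow> 's set) \<Rightarrow> ('s, 'a) nmatrix set \<Rightarrow> ('s, 'a) nmatrix set" where
  "SubN Sg K =
     {N. is_nmatrix Sg N \<and> (\<exists>M \<in> K. \<exists>N'. subnmatrix Sg N' M \<and> isomorphic Sg N' N)}"

definition HomInv_s ::
  "(nat \<Rightarrow> 's set) \<Rightarrow> ('s, 'a) nmatrix set \<Rightarrow> ('s, 'b) nmatrix set" where
  "HomInv_s Sg K =
     {N. is_nmatrix Sg N \<and>
        (\<exists>M \<in> K. \<exists>(N' :: ('s, 'b) nmatrix) h. is_nmatrix Sg N' \<and>
           strict_hom Sg h N' M \<and> covering Sg h N' M \<and> isomorphic Sg N' N)}"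

definition Hom_s ::
  "(nat \<Rightarrow> 's set) \<Rightarrow> 'p set \<Rightarrow> ('s, 'p) conseq \<Rightarrow> ('s, 'a) nmatrix set \<Rightarrow> ('s, 'b) nmatrix set"
  where
  "Hom_s Sg P R K =
     {N. is_nmatrix Sg N \<and>
        (\<exists>M \<in> K. \<exists>r. equiv (vals M) r \<and> compatible M r \<and>
           sound Sg P R (quot M r) \<and> isomorphic Sg (quot M r) N)}"

definition UProd ::
  "'i itself \<Rightarrow> (nat \<Rightarrow> 's set) \<Rightarrow> ('s, 'a) nmatrix set \<Rightarrow> ('s, 'b) nmatrix set" where
  "UProd _ Sg K =
     {N. is_nmatrix Sg N \<and>
        (\<exists>(I :: 'i set) U F. ultrafilter_on I U \<and> (\<forall>i \<in> I. F i \<in> K) \<and>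
           isomorphic Sg (ultraproduct I U F) N)}"

section \<open>Nullary connectives\<close>

text \<open>Unlike a connective of positive arity, a nullary connective has a single occurrence \<open>Con c []\<close>
  in the set of formulas, so no consequence relation constrains how several of its values interact.
  Let \<open>c\<close> be the only connective and let \<open>N\<close>, \<open>N0\<close>, \<open>N1\<close> have values \<open>{0, 1}\<close>, designated set
  \<open>{1}\<close>, and interpret \<open>c\<close> by \<open>{0, 1}\<close>, \<open>{0}\<close>, \<open>{1}\<close> respectively. The valuations of \<open>N\<close> are those
  of \<open>N0\<close> together with those of \<open>N1\<close>, so \<open>N\<close> is sound for the (compact) relation of
  \<open>{N0, N1}\<close>. But in everything obtained from \<open>{N0, N1}\<close> by \<open>UProd\<close>, \<open>SubN\<close>, \<open>HomInv_s\<close> and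
  \<open>Hom_s\<close>, the values of \<open>c\<close> are all designated or all undesignated. Hence the need to tell apart
  the Nmatrices in which nullary connectives are single-valued.\<close>

definition nullary_det :: "(nat \<Rightarrow> 's set) \<Rightarrow> ('s, 'a) nmatrix \<Rightarrow> bool" where
  "nullary_det Sg N \<longleftrightarrow> (\<forall>c \<in> Sg 0. is_singleton (interp N c []))"

end

theory Submission
  imports Defs
begin

text \<open>Let \<open>N\<close> be sound.  On formulas over variables indexed by pairs of values of \<open>N\<close> there is a
  valuation \<open>v\<close> such that every value of \<open>N\<close>, and every \<open>b\<close> in every \<open>c(x\<^sub>1, \<dots>, x\<^sub>k)\<close>, is
  attained by \<open>v\<close> at a suitable formula.  After renaming variables, soundness says that on each finite
  set of formulas the designation pattern of \<open>v\<close> is realised by a valuation in some member of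
  \<open>\<M>\<close>; an ultraproduct over the finite sets of formulas realises the whole pattern by a
  valuation \<open>w\<close>.  The Nmatrix of formulas, designated according to this common pattern, is then a
  strict preimage of the image of \<open>w\<close>, and \<open>N\<close> is its quotient by the kernel of \<open>v\<close>.\<close>

section \<open>Cardinality of sets of formulas\<close>

lemma lepoll_iff_card_of_ordLeq: "A \<lesssim> B \<longleftrightarrow> ordLeq3 (card_of A) (card_of B)"
  unfolding lepoll_def card_of_ordLeq ..

lemma times_lepoll_infinite:
  assumes "infinite C" "A \<lesssim> C" "B \<lesssim> C"
  shows "A \<times> B \<lesssim> C"
proof -
  have "C \<times> C \<approx> C"
    using card_of_Times_same_infinite[OF assms(1)] by (simp add: eqpoll_iff_card_of_ordIso)
  then show ?thesis
    using times_lepoll_mono[OF assms(2,3)] lepoll_trans2 by blast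
qed

lemma UN_nat_lepoll_infinite:
  fixes A :: "nat \<Rightarrow> 'a set"
  assumes "infinite C" "\<And>n. A n \<lesssim> C"
  shows "(\<Union>n. A n) \<lesssim> C"
  using card_of_UNION_ordLeq_infinite[of C "UNIV :: nat set" A] assms
  by (simp add: lepoll_iff_card_of_ordLeq infinite_iff_card_of_nat)

lemma Un_lepoll_infinite:
  assumes "infinite C" "A \<lesssim> C" "B \<lesssim> C"
  shows "A \<union> B \<lesssim> C"
proof -
  have "(\<Union>n::nat. if n = 0 then A else B) \<lesssim> C"
    using assms by (intro UN_nat_lepoll_infinite) auto
  moreover have "A \<union> B \<subseteq> (\<Union>n::nat. if n = 0 then A else B)"
    by (auto split: if_splits)
  ultimately show ?thesis
    by (meson lepoll_trans subset_imp_lepoll)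
qed

lemma countable_lepoll_infinite:
  assumes "countable A" "infinite C"
  shows "A \<lesssim> C"
proof -
  have "A \<lesssim> (UNIV :: nat set)"
    using assms(1) by (auto simp: countable_def lepoll_def)
  then show ?thesis
    using assms(2) infinite_le_lepoll lepoll_trans by blast
qed

text \<open>Induction on the length, using that an infinite \<open>C\<close> absorbs products,
  bounds the lists of each length; a countable union then covers all lengths.\<close>

lemma lists_lepoll_infinite:
  assumes "infinite C" "A \<lesssim> C"
  shows "lists A \<lesssim> C"
proof -
  have "{xs \<in> lists A. length xs = n} \<lesssim> C" for n
  proof (induction n)
    case 0
    have "{xs \<in> lists A. length xs = 0} \<subseteq> {[]}"
      by auto
    then have "countable {xs \<in> lists A. length xs = 0}"
      using countable_subset by fastforce
    then show ?case
      using assms(1) by (rule countable_lepoll_infinite)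
  next
    case (Suc n)
    have "{xs \<in> lists A. length xs = Suc n} \<subseteq>
        (\<lambda>(x, xs). x # xs) ` (A \<times> {xs \<in> lists A. length xs = n})"
      by (force simp: length_Suc_conv)
    then have "{xs \<in> lists A. length xs = Suc n} \<lesssim> A \<times> {xs \<in> lists A. length xs = n}"
      by (rule subset_image_lepoll)
    then show ?case
      using times_lepoll_infinite[OF assms Suc] lepoll_trans by blast
  qed
  then have "(\<Union>n. {xs \<in> lists A. length xs = n}) \<lesssim> C"
    by (intro UN_nat_lepoll_infinite assms(1))
  then show ?thesis
    by (rule lepoll_trans[OF subset_imp_lepoll, rotated]) auto
qed

lemma Fpow_lepoll_infinite:
  assumes "infinite C" "A \<lesssim> C"
  shows "Fpow A \<lesssim> C"
proof -
  have "Fpow A \<subseteq> set ` lists A"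
  proof
    fix X assume "X \<in> Fpow A"
    then obtain xs where "set xs = X" "X \<subseteq> A"
      using finite_list[of X] by (auto simp: Fpow_def)
    then show "X \<in> set ` lists A"
      by auto
  qed
  then show ?thesis
    using lists_lepoll_infinite[OF assms] by (rule lepoll_trans[OF subset_image_lepoll])
qed

text \<open>Stratified by size, each layer consists of variables and of connectives from a countable
  set applied to lists from the layer below. The bound makes the types of indices and of formula
  codes large enough.\<close>

lemma Fm_lepoll_infinite:
  assumes "infinite C" "countable (\<Union>k. Sg k)" "Q \<lesssim> C"
  shows "Fm Sg Q \<lesssim> C"
proof -
  define A where "A n = {\<phi> \<in> Fm Sg Q. size \<phi> < n}" for n
  have "A n \<lesssim> C" for n
  proof (induction n)
    case 0
    then show ?case by (simp add: A_def)
  next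
    case (Suc n)
    have "A (Suc n) \<subseteq> Var ` Q \<union> (\<lambda>(c, \<phi>s). Con c \<phi>s) ` ((\<Union>k. Sg k) \<times> lists (A n))"
    proof
      fix \<phi> assume "\<phi> \<in> A (Suc n)"
      then have "\<phi> \<in> Fm Sg Q" and size: "size \<phi> < Suc n"
        by (auto simp: A_def)
      then show "\<phi> \<in> Var ` Q \<union> (\<lambda>(c, \<phi>s). Con c \<phi>s) ` ((\<Union>k. Sg k) \<times> lists (A n))"
      proof cases
        case (Con c \<phi>s)
        \<comment> \<open>\<open>Con\<close> adds one to the sizes of its arguments, so the bound
          drops from \<open>Suc n\<close> to \<open>n\<close>.\<close>
        have "size \<psi> < n" if "\<psi> \<in> set \<phi>s" for \<psi>
          using size size_list_estimation'[OF that, of "size \<psi>" size] Con(1) by simp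
        then have "\<phi>s \<in> lists (A n)"
          using Con by (auto simp: A_def)
        then show ?thesis
          using Con by force
      qed auto
    qed
    moreover have "Var ` Q \<lesssim> C"
      using assms(3) by (rule lepoll_trans[OF image_lepoll])
    moreover have "(\<Union>k. Sg k) \<times> lists (A n) \<lesssim> C"
      by (intro times_lepoll_infinite countable_lepoll_infinite lists_lepoll_infinite assms Suc)
    then have "(\<lambda>(c, \<phi>s). Con c \<phi>s) ` ((\<Union>k. Sg k) \<times> lists (A n)) \<lesssim> C"
      by (rule lepoll_trans[OF image_lepoll])
    ultimately show ?case
      by (rule lepoll_trans[OF subset_imp_lepoll Un_lepoll_infinite[OF assms(1)]])
  qed
  then have "(\<Union>n. A n) \<lesssim> C"
    by (intro UN_nat_lepoll_infinite assms(1))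
  moreover have "Fm Sg Q \<subseteq> (\<Union>n. A n)"
    by (auto simp: A_def)
  ultimately show ?thesis
    by (meson lepoll_trans subset_imp_lepoll)
qed

section \<open>Ultrafilters\<close>

text \<open>A family that is maximal, by Zorn, among those with the finite intersection property is
  an ultrafilter.\<close>

lemma ultrafilter_on_UNIV_exists:
  fixes C :: "'i set set"
  assumes "\<And>F. finite F \<Longrightarrow> F \<subseteq> C \<Longrightarrow> \<Inter>F \<noteq> {}"
  obtains U where "ultrafilter_on UNIV U" "C \<subseteq> U"
proof -
  define fip where "fip A \<longleftrightarrow> (\<forall>F. finite F \<and> F \<subseteq> A \<longrightarrow> \<Inter>F \<noteq> {})" for A :: "'i set set"
  have "\<exists>U \<in> {A. C \<subseteq> A \<and> fip A}. \<forall>X \<in> {A. C \<subseteq> A \<and> fip A}. U \<subseteq> X \<longrightarrow> X = U"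
  proof (rule subset_Zorn_nonempty)
    show "{A. C \<subseteq> A \<and> fip A} \<noteq> {}"
      using assms by (auto simp: fip_def)
    fix K assume "K \<noteq> {}" and K: "subset.chain {A. C \<subseteq> A \<and> fip A} K"
    have "fip (\<Union>K)"
      unfolding fip_def
    proof (intro allI impI)
      fix F assume "finite F \<and> F \<subseteq> \<Union>K"
      then obtain A where "A \<in> K" "F \<subseteq> A"
        using \<open>K \<noteq> {}\<close> K finite_subset_Union_chain by metis
      then show "\<Inter>F \<noteq> {}"
        using K \<open>finite F \<and> F \<subseteq> \<Union>K\<close> by (auto simp: subset.chain_def fip_def)
    qed
    moreover have "C \<subseteq> \<Union>K"
      using \<open>K \<noteq> {}\<close> K by (fastforce simp: subset.chain_def)
    ultimately show "\<Union>K \<in> {A. C \<subseteq> A \<and> fip A}"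
      by simp
  qed
  then obtain U where U: "C \<subseteq> U" "fip U" and max: "\<And>A. fip A \<Longrightarrow> U \<subseteq> A \<Longrightarrow> A = U"
    by (metis (mono_tags, lifting) mem_Collect_eq subset_trans)
  \<comment> \<open>Maximality: a set meeting every finite intersection from \<open>U\<close> could
    be added to \<open>U\<close>, so it is already there.\<close>
  have memI: "X \<in> U" if X: "\<And>F. finite F \<Longrightarrow> F \<subseteq> U \<Longrightarrow> X \<inter> \<Inter>F \<noteq> {}" for X
  proof -
    have "fip (insert X U)"
      unfolding fip_def
    proof (intro allI impI)
      fix F assume F: "finite F \<and> F \<subseteq> insert X U"
      then have "X \<inter> \<Inter>(F - {X}) \<noteq> {}"
        by (intro X) auto
      then show "\<Inter>F \<noteq> {}"
        by auto
    qed
    then show ?thesis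
      using max by blast
  qed
  have inter: "\<Inter>F \<noteq> {}" if "finite F" "F \<subseteq> U" for F
    using U that by (auto simp: fip_def)
  \<comment> \<open>Allowing any finite \<open>G\<close> covers all closure properties at once: the
    empty \<open>G\<close> gives \<open>UNIV\<close>, singletons give supersets, pairs give
    intersections, and a \<open>G\<close> witnessing the failure of \<open>memI\<close> gives
    complements.\<close>
  have upward: "Y \<in> U" if "finite G" "G \<subseteq> U" "\<Inter>G \<subseteq> Y" for G Y
  proof (rule memI)
    fix F assume "finite F" "F \<subseteq> U"
    then have "\<Inter>(G \<union> F) \<noteq> {}"
      using that by (intro inter) auto
    then show "Y \<inter> \<Inter>F \<noteq> {}"
      using that by auto
  qed
  have "UNIV - X \<in> U" if X: "X \<notin> U" for X
  proof -
    obtain G where "finite G" "G \<subseteq> U" "X \<inter> \<Inter>G = {}"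
      using memI X by metis
    then show ?thesis
      by (intro upward[of G]) auto
  qed
  moreover have "{} \<notin> U"
    using inter[of "{{}}"] by auto
  moreover have "X \<inter> Y \<in> U" if "X \<in> U" "Y \<in> U" for X Y
    using that by (intro upward[of "{X, Y}"]) auto
  moreover have "Y \<in> U" if "X \<in> U" "X \<subseteq> Y" for X Y
    using that by (intro upward[of "{X}"]) auto
  moreover have "UNIV \<in> U"
    by (rule upward[of "{}"]) auto
  ultimately have "ultrafilter_on UNIV U"
    unfolding ultrafilter_on_def by (intro conjI ballI allI impI; metis Pow_UNIV subset_UNIV)
  then show thesis
    using that U by blast
qed

lemma ultrafilter_onD:
  assumes "ultrafilter_on I U"
  shows "X \<in> U \<Longrightarrow> X \<subseteq> I" "I \<in> U" "{} \<notin> U"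
    and "X \<in> U \<Longrightarrow> Y \<in> U \<Longrightarrow> X \<inter> Y \<in> U"
    and "X \<in> U \<Longrightarrow> X \<subseteq> Y \<Longrightarrow> Y \<subseteq> I \<Longrightarrow> Y \<in> U"
    and "X \<subseteq> I \<Longrightarrow> X \<in> U \<or> I - X \<in> U"
proof -
  have D: "U \<subseteq> Pow I \<and> I \<in> U \<and> {} \<notin> U" "\<forall>X \<in> U. \<forall>Y \<in> U. X \<inter> Y \<in> U"
    "\<forall>X \<in> U. \<forall>Y. X \<subseteq> Y \<and> Y \<subseteq> I \<longrightarrow> Y \<in> U" "\<forall>X. X \<subseteq> I \<longrightarrow> X \<in> U \<or> I - X \<in> U"
    using assms unfolding ultrafilter_on_def by argo+
  show "X \<in> U \<Longrightarrow> X \<subseteq> I" "I \<in> U" "{} \<notin> U"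
    using D(1) by auto
  show "X \<in> U \<Longrightarrow> Y \<in> U \<Longrightarrow> X \<inter> Y \<in> U"
    using D(2) by simp
  show "X \<in> U \<Longrightarrow> X \<subseteq> Y \<Longrightarrow> Y \<subseteq> I \<Longrightarrow> Y \<in> U"
    using D(3) by metis
  show "X \<subseteq> I \<Longrightarrow> X \<in> U \<or> I - X \<in> U"
    using D(4) by simp
qed

text \<open>Serves to pass to a large set of indices at which the designated sets are all empty or
  all nonempty.\<close>

lemma ultrafilter_on_restrict:
  assumes "ultrafilter_on I U" "J \<in> U"
  shows "ultrafilter_on J {X \<in> U. X \<subseteq> J}"
proof -
  note D = ultrafilter_onD[OF assms(1)]
  have "J \<subseteq> I"
    using D(1) assms(2) .
  have compl_J: "J - X \<in> U" if "X \<subseteq> J" "X \<notin> U" for X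
  proof -
    have "J \<inter> (I - X) \<in> U"
      using that \<open>J \<subseteq> I\<close> D(6)[of X] D(4)[OF assms(2), of "I - X"] by auto
    moreover have "J \<inter> (I - X) = J - X"
      using \<open>J \<subseteq> I\<close> by auto
    ultimately show ?thesis by simp
  qed
  show ?thesis
    unfolding ultrafilter_on_def
  proof (intro conjI ballI allI impI)
    fix X Y assume "X \<in> {X \<in> U. X \<subseteq> J}" "X \<subseteq> Y \<and> Y \<subseteq> J"
    then show "Y \<in> {X \<in> U. X \<subseteq> J}"
      using D(5)[of X Y] \<open>J \<subseteq> I\<close> by auto
  next
    fix X assume "X \<subseteq> J"
    then show "X \<in> {X \<in> U. X \<subseteq> J} \<or> J - X \<in> {X \<in> U. X \<subseteq> J}"
      using compl_J[of X] by auto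
  next
    fix X Y assume "X \<in> {X \<in> U. X \<subseteq> J}" "Y \<in> {X \<in> U. X \<subseteq> J}"
    then show "X \<inter> Y \<in> {X \<in> U. X \<subseteq> J}"
      using D(4)[of X Y] by auto
  qed (use assms(2) D(3) in auto)
qed

section \<open>Homomorphisms of Nmatrices\<close>

lemma map_in_tuples:
  assumes "xs \<in> tuples k A" "h ` A \<subseteq> B"
  shows "map h xs \<in> tuples k B"
  using assms by (auto simp: tuples_def)

lemma tuples_image_obtain:
  assumes "xs \<in> tuples k (h ` A)"
  obtains ys where "ys \<in> tuples k A" "map h ys = xs"
proof -
  have "xs \<in> map h ` lists A"
    using assms by (auto simp: tuples_def lists_image[symmetric])
  then obtain ys where "ys \<in> lists A" "map h ys = xs"
    by auto
  then show thesis
    using assms by (intro that) (auto simp: tuples_def)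
qed

text \<open>Homomorphisms carry valuations forward by composition; strictness preserves designation
  in both directions.\<close>

lemma valuation_strict_hom:
  assumes "strict_hom Sg h M N" "valuation Sg P M v"
  shows "valuation Sg P N (h \<circ> v)"
    and "\<phi> \<in> Fm Sg P \<Longrightarrow> h (v \<phi>) \<in> desig N \<longleftrightarrow> v \<phi> \<in> desig M"
proof -
  have "(h \<circ> v) (Con c \<phi>s) \<in> interp N c (map (h \<circ> v) \<phi>s)"
    if "c \<in> Sg k" "\<phi>s \<in> tuples k (Fm Sg P)" for c k \<phi>s
  proof -
    have "map v \<phi>s \<in> tuples k (vals M)"
      using assms(2) that by (intro map_in_tuples) (auto simp: valuation_def)
    then have "h ` interp M c (map v \<phi>s) \<subseteq> interp N c (map h (map v \<phi>s))"
      using assms(1) that unfolding strict_hom_def is_hom_def by blast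
    then show ?thesis
      using assms(2) that unfolding valuation_def by fastforce
  qed
  then show "valuation Sg P N (h \<circ> v)"
    using assms by (auto simp: valuation_def strict_hom_def is_hom_def)
  show "\<phi> \<in> Fm Sg P \<Longrightarrow> h (v \<phi>) \<in> desig N \<longleftrightarrow> v \<phi> \<in> desig M"
    using assms by (auto simp: valuation_def strict_hom_def)
qed

text \<open>A valuation of \<open>M\<close> refuting a pair becomes, after composition with
  \<open>h\<close>, a valuation of \<open>N\<close> refuting the same pair.\<close>

lemma entails_strict_hom:
  assumes "strict_hom Sg h M N"
  shows "entails Sg P N \<subseteq> entails Sg P M"
proof safe
  fix \<Gamma> \<Delta> assume *: "(\<Gamma>, \<Delta>) \<in> entails Sg P N"
  have "v ` \<Delta> \<inter> desig M \<noteq> {}" if v: "valuation Sg P M v" "v ` \<Gamma> \<subseteq> desig M" for v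
  proof -
    have Fm: "\<Gamma> \<subseteq> Fm Sg P" "\<Delta> \<subseteq> Fm Sg P"
      using * by (auto simp: entails_def)
    note h = valuation_strict_hom[OF assms v(1)]
    have "(h \<circ> v) ` \<Gamma> \<subseteq> desig N"
      using h(2) v(2) Fm by auto
    then have "(h \<circ> v) ` \<Delta> \<inter> desig N \<noteq> {}"
      using * h(1) unfolding entails_def by blast
    then obtain \<phi> where "\<phi> \<in> \<Delta>" "h (v \<phi>) \<in> desig N"
      by auto
    then show ?thesis
      using h(2)[of \<phi>] Fm by auto
  qed
  then show "(\<Gamma>, \<Delta>) \<in> entails Sg P M"
    using * by (auto simp: entails_def)
qed

text \<open>A strict homomorphism out of \<open>N\<close> is what lets consequence pass from
  \<open>M\<close> to \<open>N\<close> by \<open>entails_strict_hom\<close>.\<close>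

lemma is_iso_inv_into:
  assumes "is_iso Sg h M N" "is_nmatrix Sg M" "is_nmatrix Sg N"
  shows "strict_hom Sg (inv_into (vals M) h) N M"
proof -
  let ?g = "inv_into (vals M) h"
  have inj: "inj_on h (vals M)" and vals: "vals N = h ` vals M"
    and desig: "\<And>x. x \<in> vals M \<Longrightarrow> h x \<in> desig N \<longleftrightarrow> x \<in> desig M"
    using assms(1) by (auto simp: is_iso_def strict_hom_def bij_betw_def)
  have interp: "?g ` interp N c xs \<subseteq> interp M c (map ?g xs)"
    if c: "c \<in> Sg k" "xs \<in> tuples k (vals N)" for c k xs
  proof -
    obtain ys where ys: "ys \<in> tuples k (vals M)" "map h ys = xs"
      using c(2) vals by (metis tuples_image_obtain)
    then have "map ?g xs = ys"
      using inj by (auto simp: tuples_def subset_iff intro!: map_idI inv_into_f_f)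
    moreover have "interp N c xs = h ` interp M c ys"
      using assms(1) that ys by (auto simp: is_iso_def)
    moreover have "interp M c ys \<subseteq> vals M"
      using assms(2) that ys by (auto simp: is_nmatrix_def)
    ultimately show ?thesis
      using inj by (auto simp: subset_iff)
  qed
  have "?g ` vals N \<subseteq> vals M"
    by (simp add: vals inv_into_image_cancel inj)
  moreover have "?g -` desig M \<inter> vals N = desig N"
  proof -
    have "desig N \<subseteq> vals N"
      using assms(3) by (simp add: is_nmatrix_def)
    then show ?thesis using inj desig vals by (auto)
  qed
  ultimately show ?thesis
    using interp inj desig vals by (auto simp: strict_hom_def is_hom_def)
qed

text \<open>Values are collected over all representatives of the argument classes, so any
  equivalence will do and no congruence condition arises.\<close>

lemma is_nmatrix_quot:
  assumes "is_nmatrix Sg M" "equiv (vals M) r"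
  shows "is_nmatrix Sg (quot M r)"
proof -
  have sub: "ys \<in> tuples k (vals M)"
    if "list_all2 (\<in>) ys Xs" "Xs \<in> tuples k (vals M // r)" for ys Xs k
  proof -
    have "set ys \<subseteq> vals M"
    proof
      fix y assume "y \<in> set ys"
      then obtain i where i: "i < length ys" "y = ys ! i"
        by (auto simp: in_set_conv_nth)
      then have "y \<in> Xs ! i" "Xs ! i \<in> vals M // r"
        using that by (auto simp: list_all2_conv_all_nth tuples_def)
      then show "y \<in> vals M"
        using in_quotient_imp_subset[OF assms(2)] by blast
    qed
    then show ?thesis
      using that by (auto simp: tuples_def dest: list_all2_lengthD)
  qed
  have ex: "\<exists>ys. list_all2 (\<in>) ys Xs" if "Xs \<in> tuples k (vals M // r)" for Xs k
  proof -
    \<comment> \<open>Chosen representatives form an argument tuple of \<open>M\<close>, which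
      guarantees at least one value.\<close>
    have "list_all2 (\<in>) (map (\<lambda>X. SOME x. x \<in> X) Xs) Xs"
      unfolding list_all2_conv_all_nth
    proof (intro conjI allI impI)
      fix i assume "i < length (map (\<lambda>X. SOME x. x \<in> X) Xs)"
      then have "Xs ! i \<in> vals M // r" "i < length Xs"
        using that by (auto simp: tuples_def)
      then show "map (\<lambda>X. SOME x. x \<in> X) Xs ! i \<in> Xs ! i"
        using in_quotient_imp_non_empty[OF assms(2)] by (auto simp: some_in_eq)
    qed simp
    then show ?thesis ..
  qed
  show ?thesis
    unfolding is_nmatrix_def
  proof (intro conjI allI ballI)
    show "vals (quot M r) \<noteq> {}" "desig (quot M r) \<subseteq> vals (quot M r)"
      using assms(1) by (auto simp: quot_def is_nmatrix_def intro: quotientI)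
  next
    fix k c Xs assume c: "c \<in> Sg k" and "Xs \<in> tuples k (vals (quot M r))"
    then have Xs: "Xs \<in> tuples k (vals M // r)"
      by (simp add: quot_def)
    have interp: "interp M c ys \<subseteq> vals M" "interp M c ys \<noteq> {}" if "list_all2 (\<in>) ys Xs" for ys
      using assms(1) c sub[OF that Xs] unfolding is_nmatrix_def by blast+
    then show "interp (quot M r) c Xs \<subseteq> vals (quot M r)"
      by (fastforce simp: quot_def intro: quotientI)
    show "interp (quot M r) c Xs \<noteq> {}"
      using ex[OF Xs] interp(2) by (fastforce simp: quot_def)
  qed
qed

text \<open>The easy inclusion: soundness of the quotient is built into \<open>Hom_s\<close> and
  only has to cross the isomorphism.\<close>

lemma Hom_s_subset_Nmatr:
  assumes "\<And>M. M \<in> K \<Longrightarrow> is_nmatrix Sg M"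
  shows "Hom_s Sg P R K \<subseteq> Nmatr Sg P R"
proof
  fix N assume "N \<in> Hom_s Sg P R K"
  then obtain M r h where N: "is_nmatrix Sg N" and M: "M \<in> K" "equiv (vals M) r"
    and sound: "sound Sg P R (quot M r)" and h: "is_iso Sg h (quot M r) N"
    unfolding Hom_s_def isomorphic_def by blast
  have "is_nmatrix Sg (quot M r)"
    using assms M is_nmatrix_quot by blast
  then have "entails Sg P (quot M r) \<subseteq> entails Sg P N"
    using is_iso_inv_into[OF h _ N] entails_strict_hom by blast
  then show "N \<in> Nmatr Sg P R"
    using N sound by (auto simp: Nmatr_def sound_def)
qed

section \<open>Images, kernel quotients and isomorphic copies\<close>

text \<open>Factors \<open>h\<close> through its image, which inherits its designated values from
  \<open>M\<close>; so \<open>SubN\<close> and \<open>HomInv_s\<close> can be applied one after the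
  other.\<close>

lemma image_nmatrix_strict_hom:
  assumes "is_nmatrix Sg T" "is_nmatrix Sg M" "strict_hom Sg h T M"
  shows "subnmatrix Sg (image_nmatrix h T M) M"
    and "strict_hom Sg h T (image_nmatrix h T M)"
    and "covering Sg h T (image_nmatrix h T M)"
proof -
  have hom: "\<And>k c ys. c \<in> Sg k \<Longrightarrow> ys \<in> tuples k (vals T) \<Longrightarrow>
      h ` interp T c ys \<subseteq> interp M c (map h ys)"
    and nm: "\<And>k c ys. c \<in> Sg k \<Longrightarrow> ys \<in> tuples k (vals T) \<Longrightarrow>
      interp T c ys \<subseteq> vals T \<and> interp T c ys \<noteq> {}"
    using assms by (auto simp: strict_hom_def is_hom_def is_nmatrix_def)
  have interp: "interp (image_nmatrix h T M) c xs \<subseteq> h ` vals T"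
    "interp (image_nmatrix h T M) c xs \<noteq> {}"
    "interp (image_nmatrix h T M) c xs \<subseteq> interp M c xs"
    if c: "c \<in> Sg k" "xs \<in> tuples k (h ` vals T)" for c k xs
  proof -
    have ys: "ys \<in> tuples k (vals T)" if "set ys \<subseteq> vals T" "map h ys = xs" for ys
      using c that by (auto simp: tuples_def)
    obtain ys where "ys \<in> tuples k (vals T)" "map h ys = xs"
      using c(2) by (rule tuples_image_obtain)
    then show "interp (image_nmatrix h T M) c xs \<noteq> {}"
      using nm[OF c(1), of ys] by (auto simp: image_nmatrix_def tuples_def)
    show "interp (image_nmatrix h T M) c xs \<subseteq> h ` vals T"
      using nm[OF c(1) ys] by (fastforce simp: image_nmatrix_def)
    show "interp (image_nmatrix h T M) c xs \<subseteq> interp M c xs"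
      using hom[OF c(1) ys] by (fastforce simp: image_nmatrix_def)
  qed
  have vals: "vals (image_nmatrix h T M) = h ` vals T"
    and desig: "desig (image_nmatrix h T M) = desig M \<inter> h ` vals T"
    by (auto simp: image_nmatrix_def)
  show "subnmatrix Sg (image_nmatrix h T M) M"
    unfolding subnmatrix_def is_nmatrix_def vals desig using assms interp
    by (auto 0 0 simp: is_nmatrix_def strict_hom_def is_hom_def)
  show "strict_hom Sg h T (image_nmatrix h T M)"
    unfolding strict_hom_def is_hom_def vals desig
  proof (intro conjI allI ballI)
    fix k c xs assume "c \<in> Sg k" "xs \<in> tuples k (vals T)"
    then show "h ` interp T c xs \<subseteq> interp (image_nmatrix h T M) c (map h xs)"
      by (auto simp: image_nmatrix_def tuples_def)
  qed (use assms in \<open>auto simp: strict_hom_def is_hom_def is_nmatrix_def\<close>)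
  show "covering Sg h T (image_nmatrix h T M)"
    by (auto simp: covering_def same_nmatrix_def image_nmatrix_def)
qed

text \<open>First isomorphism theorem: strictness makes the kernel compatible, and covering makes
  the multivalued operations of the quotient match those of \<open>N\<close>.\<close>

lemma quot_kernel_iso:
  assumes "is_nmatrix Sg M" "is_nmatrix Sg N" "strict_hom Sg f M N" "covering Sg f M N"
  defines "r \<equiv> {(x, y). x \<in> vals M \<and> y \<in> vals M \<and> f x = f y}"
  shows "equiv (vals M) r" "compatible M r" "isomorphic Sg (quot M r) N"
proof -
  show r: "equiv (vals M) r"
    by (auto simp: r_def equiv_def refl_on_def sym_def trans_def)
  have desig: "\<And>x. x \<in> vals M \<Longrightarrow> f x \<in> desig N \<longleftrightarrow> x \<in> desig M"
    using assms(3) by (auto simp: strict_hom_def)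
  have "x \<in> desig M \<longleftrightarrow> y \<in> desig M" if "x \<in> vals M" "y \<in> vals M" "f x = f y" for x y
    using that desig[of x] desig[of y] by simp
  then show "compatible M r"
    by (auto simp: compatible_def r_def)
  have vals: "vals N = f ` vals M"
    using assms(4) by (auto simp: covering_def same_nmatrix_def image_nmatrix_def)
  have interp: "interp N c (map f xs) =
      {f y | y ys. set ys \<subseteq> vals M \<and> map f ys = map f xs \<and> y \<in> interp M c ys}"
    if "c \<in> Sg k" "xs \<in> tuples k (vals M)" for c k xs
  proof -
    have "map f xs \<in> tuples k (f ` vals M)"
      using that map_in_tuples by blast
    then show ?thesis
      using assms(4) that by (auto simp: covering_def same_nmatrix_def image_nmatrix_def)
  qed
  have desig_sub: "desig M \<subseteq> vals M" "desig N \<subseteq> vals N"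
    using assms(1,2) by (auto simp: is_nmatrix_def)
  \<comment> \<open>The induced map applies \<open>f\<close> to a chosen representative; the choice
    is harmless because \<open>f\<close> is constant on kernel classes.\<close>
  define h where "h X = f (SOME x. x \<in> X)" for X
  have h: "h (r `` {x}) = f x" if "x \<in> vals M" for x
  proof -
    have "x \<in> r `` {x}"
      using that by (simp add: r_def)
    then have "(SOME y. y \<in> r `` {x}) \<in> r `` {x}"
      by (rule someI)
    moreover have "\<forall>y \<in> r `` {x}. f y = f x"
      by (auto simp: r_def)
    ultimately show ?thesis
      unfolding h_def by blast
  qed
  have class_eq: "r `` {x} = r `` {y} \<longleftrightarrow> f x = f y" if "x \<in> vals M" "y \<in> vals M" for x y
    using that eq_equiv_class_iff[OF r] by (auto simp: r_def)
  have "bij_betw h (vals M // r) (vals N)"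
    unfolding bij_betw_def
  proof
    show "inj_on h (vals M // r)"
    proof (rule inj_onI)
      fix X Y assume "X \<in> vals M // r" "Y \<in> vals M // r" "h X = h Y"
      then show "X = Y"
        by (elim quotientE) (simp add: h class_eq)
    qed
    show "h ` (vals M // r) = vals N"
      using h by (force simp: vals quotient_def image_iff)
  qed
  moreover have "h -` desig N \<inter> (vals M // r) = {r `` {x} |x. x \<in> desig M}"
    using desig_sub by (auto elim!: quotientE simp: h desig subset_iff intro: quotientI)
  moreover have "h ` interp (quot M r) c Xs = interp N c (map h Xs)"
    if c: "c \<in> Sg k" and Xs: "Xs \<in> tuples k (vals M // r)" for c k Xs
  proof -
    have "vals M // r = (\<lambda>x. r `` {x}) ` vals M"
      by (auto simp: quotient_def)
    then obtain xs where xs: "xs \<in> tuples k (vals M)" "map (\<lambda>x. r `` {x}) xs = Xs"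
      using Xs by (metis tuples_image_obtain)
    \<comment> \<open>The tuples representing \<open>Xs\<close> are exactly those over which
      covering collects the values at \<open>map f xs\<close>.\<close>
    have mem: "list_all2 (\<in>) ys Xs \<longleftrightarrow> set ys \<subseteq> vals M \<and> map f ys = map f xs" for ys
    proof -
      have "list_all2 (\<in>) ys Xs \<longleftrightarrow> list_all2 (\<lambda>y x. y \<in> vals M \<and> f y = f x) ys xs"
        using xs unfolding xs(2)[symmetric] list_all2_map2
        by (intro list.rel_cong refl) (auto simp: r_def tuples_def)
      also have "\<dots> \<longleftrightarrow> set ys \<subseteq> vals M \<and> map f ys = map f xs"
        by (auto simp: list_all2_conv_all_nth list_eq_iff_nth_eq set_conv_nth)
      finally show ?thesis .
    qed
    \<comment> \<open>Both operations are images of this one set: under classes for the quotient,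
      under \<open>f\<close> for \<open>N\<close>.\<close>
    define Y where "Y = {y. \<exists>ys. set ys \<subseteq> vals M \<and> map f ys = map f xs \<and> y \<in> interp M c ys}"
    have "Y \<subseteq> vals M"
    proof
      fix y assume "y \<in> Y"
      then obtain ys where "ys \<in> tuples k (vals M)" "y \<in> interp M c ys"
        using xs by (auto simp: Y_def tuples_def dest: map_eq_imp_length_eq)
      then show "y \<in> vals M"
        using assms(1) c unfolding is_nmatrix_def by blast
    qed
    moreover have "interp (quot M r) c Xs = (\<lambda>y. r `` {y}) ` Y"
      by (auto simp: quot_def mem Y_def)
    ultimately have "h ` interp (quot M r) c Xs = f ` Y"
      using h by (auto simp: image_image subset_iff)
    moreover have "map h Xs = map f xs"
      using xs h by (auto simp: tuples_def subset_iff)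
    moreover have "interp N c (map f xs) = f ` Y"
      unfolding interp[OF c xs(1)] by (auto simp: Y_def)
    ultimately show ?thesis
      by simp
  qed
  moreover have "vals (quot M r) = vals M // r" "desig (quot M r) = {r `` {x} |x. x \<in> desig M}"
    by (auto simp: quot_def)
  ultimately have "is_iso Sg h (quot M r) N"
    unfolding is_iso_def strict_hom_def is_hom_def bij_betw_def by auto
  then show "isomorphic Sg (quot M r) N"
    by (auto simp: isomorphic_def)
qed

text \<open>Transport of structure along \<open>h\<close>, used to move an ultraproduct into a
  prescribed type.\<close>

lemma isomorphic_copy_exists:
  assumes "is_nmatrix Sg M" "inj_on h (vals M)"
  obtains N where "is_nmatrix Sg N" "is_iso Sg h M N"
proof -
  define N where "N = \<lparr>vals = h ` vals M,
      interp = (\<lambda>c xs. h ` interp M c (map (inv_into (vals M) h) xs)), desig = h ` desig M\<rparr>"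
  have [simp]: "map (inv_into (vals M) h \<circ> h) xs = xs" if "xs \<in> tuples k (vals M)" for xs k
    using that assms(2) by (auto simp: tuples_def intro!: map_idI)
  have nm: "interp M c xs \<subseteq> vals M" "interp M c xs \<noteq> {}"
    if "c \<in> Sg k" "xs \<in> tuples k (vals M)" for c k xs
    using assms(1) that by (auto simp: is_nmatrix_def)
  have desig: "desig M \<subseteq> vals M" "vals M \<noteq> {}"
    using assms(1) by (auto simp: is_nmatrix_def)
  have "is_nmatrix Sg N"
    unfolding is_nmatrix_def
  proof (intro conjI allI ballI)
    fix k c xs assume c: "c \<in> Sg k" and "xs \<in> tuples k (vals N)"
    then obtain ys where ys: "ys \<in> tuples k (vals M)" "map h ys = xs"
      unfolding N_def by (metis tuples_image_obtain nmatrix.select_convs(1))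
    then have "interp N c xs = h ` interp M c ys"
      by (auto simp: N_def)
    then show "interp N c xs \<subseteq> vals N" "interp N c xs \<noteq> {}"
      using nm[OF c ys(1)] by (auto simp: N_def)
  qed (use desig in \<open>auto simp: N_def\<close>)
  moreover have "is_iso Sg h M N"
    using assms(2) desig
    by (auto simp: is_iso_def strict_hom_def is_hom_def bij_betw_def N_def dest: inj_onD)
  ultimately show thesis
    by (rule that)
qed

lemma isomorphic_refl: "is_nmatrix Sg M \<Longrightarrow> isomorphic Sg M M"
  unfolding isomorphic_def is_iso_def strict_hom_def is_hom_def
  by (rule exI[of _ id]) (auto simp: is_nmatrix_def)

section \<open>Ultraproducts\<close>

lemma is_nmatrix_product:
  assumes "\<And>i. i \<in> I \<Longrightarrow> is_nmatrix Sg (F i)"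
  shows "is_nmatrix Sg (product I F)"
  unfolding is_nmatrix_def
proof (intro conjI allI ballI)
  show "vals (product I F) \<noteq> {}"
    using assms by (auto simp: product_def is_nmatrix_def PiE_eq_empty_iff)
  show "desig (product I F) \<subseteq> vals (product I F)"
    using assms by (auto simp: product_def is_nmatrix_def intro!: PiE_mono)
next
  fix k c ss assume c: "c \<in> Sg k" and ss: "ss \<in> tuples k (vals (product I F))"
  have "map (\<lambda>s. s i) ss \<in> tuples k (vals (F i))" if "i \<in> I" for i
    using ss that by (intro map_in_tuples[OF ss]) (auto simp: product_def)
  then have "interp (F i) c (map (\<lambda>s. s i) ss) \<subseteq> vals (F i)"
    "interp (F i) c (map (\<lambda>s. s i) ss) \<noteq> {}" if "i \<in> I" for i
    using assms c that unfolding is_nmatrix_def by blast+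
  then show "interp (product I F) c ss \<subseteq> vals (product I F)" "interp (product I F) c ss \<noteq> {}"
    by (auto simp: product_def PiE_eq_empty_iff intro!: PiE_mono)
qed

lemma equiv_ultra_eq:
  assumes "ultrafilter_on I U"
  shows "equiv (vals (product I F)) (ultra_eq I U F)"
proof (rule equivI)
  note D = ultrafilter_onD[OF assms]
  show "refl_on (vals (product I F)) (ultra_eq I U F)"
    using D(2) by (auto simp: refl_on_def ultra_eq_def)
  show "ultra_eq I U F \<subseteq> vals (product I F) \<times> vals (product I F)"
    by (auto simp: ultra_eq_def)
  show "sym (ultra_eq I U F)"
    by (auto simp: sym_def ultra_eq_def eq_commute)
  show "trans (ultra_eq I U F)"
  proof (rule transI)
    fix s t u assume st: "(s, t) \<in> ultra_eq I U F" and tu: "(t, u) \<in> ultra_eq I U F"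
    then have "{i \<in> I. s i = t i} \<inter> {i \<in> I. t i = u i} \<in> U"
      by (intro D(4)) (auto simp: ultra_eq_def)
    then have "{i \<in> I. s i = u i} \<in> U"
      by (rule D(5)) auto
    then show "(s, u) \<in> ultra_eq I U F"
      using st tu by (auto simp: ultra_eq_def)
  qed
qed

lemma is_nmatrix_ultraproduct:
  assumes "ultrafilter_on I U" "\<And>i. i \<in> I \<Longrightarrow> is_nmatrix Sg (F i)"
  shows "is_nmatrix Sg (ultraproduct I U F)"
  unfolding ultraproduct_def
  using assms by (intro is_nmatrix_quot is_nmatrix_product equiv_ultra_eq)

text \<open>Valuations combine pointwise in the product, and the resulting functions represent their
  own classes in the quotient.\<close>

lemma valuation_ultraproduct:
  assumes U: "ultrafilter_on I U" and w: "\<And>i. i \<in> I \<Longrightarrow> valuation Sg Q (F i) (w i)"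
  shows "valuation Sg Q (ultraproduct I U F) (\<lambda>\<phi>. ultra_eq I U F `` {\<lambda>i\<in>I. w i \<phi>})"
proof -
  let ?w = "\<lambda>\<phi>. \<lambda>i\<in>I. w i \<phi>"
  have vals: "?w \<phi> \<in> vals (product I F)" if "\<phi> \<in> Fm Sg Q" for \<phi>
    using w that by (auto simp: product_def valuation_def)
  have interp: "?w (Con c \<phi>s) \<in> interp (product I F) c (map ?w \<phi>s)"
    if "c \<in> Sg k" "\<phi>s \<in> tuples k (Fm Sg Q)" for c k \<phi>s
  proof -
    have "map (\<lambda>s. s i) (map ?w \<phi>s) = map (w i) \<phi>s" if "i \<in> I" for i
      using that by simp
    then show ?thesis
      using w that by (auto simp: product_def valuation_def comp_def)
  qed
  show ?thesis
    unfolding valuation_def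
  proof (intro conjI allI ballI)
    fix \<phi> assume "\<phi> \<in> Fm Sg Q"
    then show "ultra_eq I U F `` {?w \<phi>} \<in> vals (ultraproduct I U F)"
      using vals by (auto simp: ultraproduct_def quot_def intro: quotientI)
  next
    fix k c \<phi>s assume c: "c \<in> Sg k" and \<phi>s: "\<phi>s \<in> tuples k (Fm Sg Q)"
    have "list_all2 (\<in>) (map ?w \<phi>s) (map (\<lambda>\<phi>. ultra_eq I U F `` {?w \<phi>}) \<phi>s)"
      unfolding list_all2_map1 list_all2_map2 list_all2_same
      using \<phi>s vals equiv_class_self[OF equiv_ultra_eq[OF U]] by (auto simp: tuples_def)
    then show "ultra_eq I U F `` {?w (Con c \<phi>s)} \<in>
        interp (ultraproduct I U F) c (map (\<lambda>\<phi>. ultra_eq I U F `` {?w \<phi>}) \<phi>s)"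
      using interp[OF c \<phi>s] unfolding ultraproduct_def quot_def by simp blast
  qed
qed

text \<open>If only some of the designated sets are empty, then the product has no designated
  values at all, whatever the ultrafilter.\<close>

lemma desig_ultraproduct_iff:
  assumes U: "ultrafilter_on I U" and F: "\<And>i. i \<in> I \<Longrightarrow> is_nmatrix Sg (F i)"
    and dichotomy: "(\<forall>i \<in> I. desig (F i) \<noteq> {}) \<or> (\<forall>i \<in> I. desig (F i) = {})"
    and s: "s \<in> vals (product I F)"
  shows "ultra_eq I U F `` {s} \<in> desig (ultraproduct I U F) \<longleftrightarrow> {i \<in> I. s i \<in> desig (F i)} \<in> U"
proof -
  note upward = ultrafilter_onD(5)[OF U]
  have "is_nmatrix Sg (product I F)"
    using F by (rule is_nmatrix_product)
  then have sub: "desig (product I F) \<subseteq> vals (product I F)"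
    by (simp add: is_nmatrix_def)
  have eq: "ultra_eq I U F `` {s} = ultra_eq I U F `` {t} \<longleftrightarrow> {i \<in> I. s i = t i} \<in> U"
    if "t \<in> desig (product I F)" for t
  proof -
    have t: "t \<in> vals (product I F)"
      using sub that by (rule subsetD)
    show ?thesis
      unfolding eq_equiv_class_iff[OF equiv_ultra_eq[OF U] s t] using s t by (simp add: ultra_eq_def)
  qed
  have "ultra_eq I U F `` {s} \<in> desig (ultraproduct I U F) \<longleftrightarrow>
      (\<exists>t \<in> desig (product I F). ultra_eq I U F `` {s} = ultra_eq I U F `` {t})"
    unfolding ultraproduct_def quot_def nmatrix.select_convs by blast
  also have "\<dots> \<longleftrightarrow> (\<exists>t \<in> desig (product I F). {i \<in> I. s i = t i} \<in> U)"
    by (rule bex_cong[OF refl eq])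
  also have "\<dots> \<longleftrightarrow> {i \<in> I. s i \<in> desig (F i)} \<in> U"
  proof
    assume "\<exists>t \<in> desig (product I F). {i \<in> I. s i = t i} \<in> U"
    then obtain t where "t \<in> desig (product I F)" "{i \<in> I. s i = t i} \<in> U"
      by blast
    then have "t i \<in> desig (F i)" if "i \<in> I" for i
      using that by (auto simp: product_def)
    then show "{i \<in> I. s i \<in> desig (F i)} \<in> U"
      by (intro upward[OF \<open>{i \<in> I. s i = t i} \<in> U\<close>]) auto
  next
    assume *: "{i \<in> I. s i \<in> desig (F i)} \<in> U"
    then have "{i \<in> I. s i \<in> desig (F i)} \<noteq> {}"
      using ultrafilter_onD(3)[OF U] by metis
    then have ne: "\<forall>i \<in> I. desig (F i) \<noteq> {}"
      using dichotomy by blast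
    \<comment> \<open>Being designated in the product is required at every index, so where
      \<open>s\<close> is undesignated \<open>t\<close> takes an arbitrary designated value
      instead.\<close>
    define t where "t = (\<lambda>i\<in>I. if s i \<in> desig (F i) then s i else SOME d. d \<in> desig (F i))"
    have "t i \<in> desig (F i)" if "i \<in> I" for i
      using ne that by (simp add: t_def some_in_eq)
    then have "t \<in> desig (product I F)"
      by (simp add: product_def t_def PiE_def Pi_def)
    moreover have "{i \<in> I. s i = t i} \<in> U"
      by (rule upward[OF *]) (auto simp: t_def)
    ultimately show "\<exists>t \<in> desig (product I F). {i \<in> I. s i = t i} \<in> U"
      by blast
  qed
  finally show ?thesis .
qed

text \<open>Distinct classes are disjoint, so chosen representatives differ and \<open>j\<close>
  separates them.\<close>

lemma inj_on_quotient_exists: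
  assumes "equiv A r" "inj_on j A"
  shows "\<exists>f. inj_on f (A // r) \<and> f ` (A // r) \<subseteq> j ` A"
proof -
  let ?f = "\<lambda>X. j (SOME x. x \<in> X)"
  have some: "(SOME x. x \<in> X) \<in> X" if "X \<in> A // r" for X
    using in_quotient_imp_non_empty[OF assms(1) that] by (simp add: some_in_eq)
  have inA: "(SOME x. x \<in> X) \<in> A" if "X \<in> A // r" for X
    using some[OF that] in_quotient_imp_subset[OF assms(1) that] by blast
  have "inj_on ?f (A // r)"
  proof (rule inj_onI)
    fix X Y assume XY: "X \<in> A // r" "Y \<in> A // r" "?f X = ?f Y"
    then have "(SOME x. x \<in> X) = (SOME x. x \<in> Y)"
      using inA assms(2) by (auto dest: inj_onD)
    then have "X \<inter> Y \<noteq> {}"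
      using some[OF XY(1)] some[OF XY(2)] by auto
    then show "X = Y"
      using quotient_disj[OF assms(1) XY(1,2)] by blast
  qed
  moreover have "?f ` (A // r) \<subseteq> j ` A"
    using inA by auto
  ultimately show ?thesis
    by (intro exI[of _ ?f] conjI)
qed

section \<open>Renaming of variables\<close>

lemma vars_Fm: "\<phi> \<in> Fm Sg Q \<Longrightarrow> set2_fm \<phi> \<subseteq> Q"
  by (induction rule: Fm.induct) auto

lemma finite_set2_fm: "finite (set2_fm \<phi>)"
  by (induction \<phi>) auto

lemma map_fm_Fm:
  assumes "\<phi> \<in> Fm Sg Q" "\<sigma> ` Q \<subseteq> P"
  shows "map_fm id \<sigma> \<phi> \<in> Fm Sg P"
  using assms(1)
proof (induction rule: Fm.induct)
  case (Var p)
  then show ?case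
    using assms(2) by (auto intro: Fm.Var)
next
  case (Con c \<phi>s)
  then show ?case
    by (auto intro!: Fm.Con)
qed

text \<open>Renaming commutes with the connectives, so valuations over \<open>P\<close> pull back to
  \<open>Q\<close>.\<close>

lemma valuation_map_fm:
  assumes "valuation Sg P M v" "\<sigma> ` Q \<subseteq> P"
  shows "valuation Sg Q M (v \<circ> map_fm id \<sigma>)"
proof -
  have "v (Con c (map (map_fm id \<sigma>) \<phi>s)) \<in> interp M c (map v (map (map_fm id \<sigma>) \<phi>s))"
    if "c \<in> Sg k" "\<phi>s \<in> tuples k (Fm Sg Q)" for c k \<phi>s
  proof -
    have "map (map_fm id \<sigma>) \<phi>s \<in> tuples k (Fm Sg P)"
      using map_fm_Fm assms(2) by (intro map_in_tuples[OF that(2)]) auto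
    then show ?thesis
      using assms(1) that unfolding valuation_def by blast
  qed
  moreover have "v (map_fm id \<sigma> \<phi>) \<in> vals M" if "\<phi> \<in> Fm Sg Q" for \<phi>
    using assms(1) map_fm_Fm[OF that assms(2)] by (simp add: valuation_def)
  ultimately show ?thesis
    by (simp add: valuation_def)
qed

text \<open>Bridges \<open>P\<close> and a \<open>Q\<close> of any size: only the finitely many
  variables in \<open>V\<close> have to survive the round trip.\<close>

lemma finite_renaming_exists:
  assumes "finite V" "V \<subseteq> Q" "Q \<noteq> {}" "infinite P"
  obtains \<sigma> \<tau> where "\<sigma> ` Q \<subseteq> P" "\<tau> ` P \<subseteq> Q" "\<And>x. x \<in> V \<Longrightarrow> \<tau> (\<sigma> x) = x"
proof -
  obtain \<sigma> where \<sigma>: "inj_on \<sigma> V" "\<sigma> ` V \<subseteq> P"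
    using finite_lepoll_infinite[OF assms(4,1)] by (auto simp: lepoll_def)
  obtain p q where "p \<in> P" "q \<in> Q"
    using assms(3,4) by (metis finite.emptyI ex_in_conv)
  \<comment> \<open>The default \<open>q\<close> keeps \<open>\<tau>\<close> inside \<open>Q\<close>
    off the image of \<open>V\<close>; likewise \<open>p\<close> stands in for
    \<open>\<sigma>\<close> off \<open>V\<close>.\<close>
  define \<tau> where "\<tau> y = (if y \<in> \<sigma> ` V then inv_into V \<sigma> y else q)" for y
  have "\<tau> y \<in> Q" for y
    using assms(2) \<open>q \<in> Q\<close> inv_into_into[of y \<sigma> V] by (auto simp: \<tau>_def)
  moreover have "(\<lambda>x. if x \<in> V then \<sigma> x else p) ` Q \<subseteq> P"
    using \<sigma> \<open>p \<in> P\<close> by auto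
  moreover have "\<tau> (if x \<in> V then \<sigma> x else p) = x" if "x \<in> V" for x
    using \<sigma> that by (simp add: \<tau>_def)
  ultimately show thesis
    by (intro that[of "\<lambda>x. if x \<in> V then \<sigma> x else p" \<tau>]) auto
qed

text \<open>The pattern of \<open>v\<close> on \<open>X\<close> amounts to refuting one finite pair.
  Renamed into \<open>P\<close>, the pair fails in \<open>N\<close>, hence by soundness in some
  member of \<open>\<M>\<close>, and the refuting valuation is pulled back to
  \<open>Q\<close>.\<close>

lemma refute_finite:
  assumes N: "sound Sg P (entails_class Sg P \<M>) N" and "infinite P" "Q \<noteq> {}"
    and v: "valuation Sg Q N v" and X: "finite X" "X \<subseteq> Fm Sg Q"
  obtains M w where "M \<in> \<M>" "valuation Sg Q M w"
    "\<And>\<phi>. \<phi> \<in> X \<Longrightarrow> w \<phi> \<in> desig M \<longleftrightarrow> v \<phi> \<in> desig N"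
proof -
  let ?V = "\<Union>\<phi> \<in> X. set2_fm \<phi>"
  have V: "finite ?V" "?V \<subseteq> Q"
    using X vars_Fm[of _ Sg Q] by (simp add: finite_set2_fm, fast)
  obtain \<sigma> \<tau> where \<sigma>: "\<sigma> ` Q \<subseteq> P" and \<tau>: "\<tau> ` P \<subseteq> Q" and inv: "\<And>x. x \<in> ?V \<Longrightarrow> \<tau> (\<sigma> x) = x"
    by (rule finite_renaming_exists[OF V \<open>Q \<noteq> {}\<close> \<open>infinite P\<close>]) blast
  let ?s = "map_fm id \<sigma>" and ?t = "map_fm id \<tau>"
  have inv_fm: "?t (?s \<phi>) = \<phi>" if "\<phi> \<in> X" for \<phi>
  proof -
    have "?t (?s \<phi>) = map_fm id (\<tau> \<circ> \<sigma>) \<phi>"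
      by (simp add: fm.map_comp)
    also have "\<dots> = map_fm id id \<phi>"
      using inv that by (intro fm.map_cong) auto
    finally show ?thesis
      by (simp add: fm.map_id)
  qed
  \<comment> \<open>Premises record the designated and conclusions the undesignated formulas, so
    refuting this pair reproduces the whole pattern on \<open>X\<close>.\<close>
  let ?\<Gamma> = "{\<phi> \<in> X. v \<phi> \<in> desig N}" and ?\<Delta> = "{\<phi> \<in> X. v \<phi> \<notin> desig N}"
  have Fm: "?s ` ?\<Gamma> \<subseteq> Fm Sg P" "?s ` ?\<Delta> \<subseteq> Fm Sg P"
    using X map_fm_Fm \<sigma> by blast+
  \<comment> \<open>The refuting valuation is \<open>v \<circ> ?t\<close>, since \<open>?t\<close>
    undoes \<open>?s\<close> on \<open>X\<close>.\<close>
  have "(?s ` ?\<Gamma>, ?s ` ?\<Delta>) \<notin> entails Sg P N"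
    using valuation_map_fm[OF v \<tau>] by (fastforce simp: entails_def inv_fm)
  then have "(?s ` ?\<Gamma>, ?s ` ?\<Delta>) \<notin> entails_class Sg P \<M>"
    using N by (auto simp: sound_def)
  then obtain M w where M: "M \<in> \<M>" "valuation Sg P M w"
      "w ` ?s ` ?\<Gamma> \<subseteq> desig M" "w ` ?s ` ?\<Delta> \<inter> desig M = {}"
    using Fm by (auto simp: entails_class_def entails_def)
  show thesis
  proof (rule that[OF M(1) valuation_map_fm[OF M(2) \<sigma>]])
    show "(w \<circ> ?s) \<phi> \<in> desig M \<longleftrightarrow> v \<phi> \<in> desig N" if "\<phi> \<in> X" for \<phi>
      using M(3,4) that by (auto simp: image_subset_iff disjoint_iff)
  qed
qed

section \<open>Nmatrices of formulas\<close>

text \<open>The algebra of formulas as a single-valued Nmatrix, coded by \<open>e\<close> because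
  its values must come from a prescribed type; for \<open>e\<close> injective on formulas,
  \<open>inv_into\<close> decodes.\<close>

definition fm_nmatrix ::
  "(nat \<Rightarrow> 's set) \<Rightarrow> 'p set \<Rightarrow> (('s, 'p) fm \<Rightarrow> 'w) \<Rightarrow> ('s, 'p) fm set \<Rightarrow> ('s, 'w) nmatrix" where
  "fm_nmatrix Sg Q e D =
     \<lparr>vals = e ` Fm Sg Q,
      interp = (\<lambda>c xs. {e (Con c (map (inv_into (Fm Sg Q) e) xs))}),
      desig = e ` D\<rparr>"

lemma Con_in_Fm: "c \<in> Sg k \<Longrightarrow> \<phi>s \<in> tuples k (Fm Sg Q) \<Longrightarrow> Con c \<phi>s \<in> Fm Sg Q"
  by (auto simp: tuples_def intro!: Fm.Con)

lemma valuation_Con: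
  "valuation Sg Q M v \<Longrightarrow> c \<in> Sg k \<Longrightarrow> \<phi>s \<in> tuples k (Fm Sg Q) \<Longrightarrow>
    v (Con c \<phi>s) \<in> interp M c (map v \<phi>s)"
  by (simp add: valuation_def)

lemma is_nmatrix_fm_nmatrix:
  assumes "Q \<noteq> {}" "D \<subseteq> Fm Sg Q"
  shows "is_nmatrix Sg (fm_nmatrix Sg Q e D)"
proof -
  have "Fm Sg Q \<noteq> {}"
    using assms(1) Fm.Var by fastforce
  moreover have "Con c (map (inv_into (Fm Sg Q) e) xs) \<in> Fm Sg Q"
    if "c \<in> Sg k" "xs \<in> tuples k (e ` Fm Sg Q)" for c k xs
    using that(1) by (rule Con_in_Fm) (rule map_in_tuples[OF that(2)], auto intro: inv_into_into)
  ultimately show ?thesis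
    using assms(2) by (simp add: is_nmatrix_def fm_nmatrix_def image_mono)
qed

text \<open>A valuation is a homomorphism from the algebra of formulas, strict once \<open>D\<close>
  is its designation pattern. Valuations with the same pattern thus share one domain.\<close>

lemma strict_hom_fm_nmatrix:
  assumes e: "inj_on e (Fm Sg Q)" and v: "valuation Sg Q M v"
    and D: "D = {\<phi> \<in> Fm Sg Q. v \<phi> \<in> desig M}"
  shows "strict_hom Sg (v \<circ> inv_into (Fm Sg Q) e) (fm_nmatrix Sg Q e D) M"
  unfolding strict_hom_def is_hom_def
proof (intro conjI allI ballI)
  let ?d = "inv_into (Fm Sg Q) e"
  show "(v \<circ> ?d) ` vals (fm_nmatrix Sg Q e D) \<subseteq> vals M"
    using v e by (auto simp: fm_nmatrix_def valuation_def)
  show "(v \<circ> ?d) ` desig (fm_nmatrix Sg Q e D) \<subseteq> desig M"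
    using e by (auto simp: fm_nmatrix_def D)
  show "(v \<circ> ?d) -` desig M \<inter> vals (fm_nmatrix Sg Q e D) = desig (fm_nmatrix Sg Q e D)"
    using e by (auto simp: fm_nmatrix_def D)
next
  fix k c xs
  let ?d = "inv_into (Fm Sg Q) e"
  assume c: "c \<in> Sg k" and "xs \<in> tuples k (vals (fm_nmatrix Sg Q e D))"
  then have xs: "map ?d xs \<in> tuples k (Fm Sg Q)"
    by (elim map_in_tuples) (auto simp: fm_nmatrix_def inv_into_into)
  have "?d (e (Con c (map ?d xs))) = Con c (map ?d xs)"
    using Con_in_Fm[of c Sg k _ Q, OF c xs] by (rule inv_into_f_f[OF e])
  then show "(v \<circ> ?d) ` interp (fm_nmatrix Sg Q e D) c xs \<subseteq> interp M c (map (v \<circ> ?d) xs)"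
    using valuation_Con[of Sg Q M v c k, OF v c xs] by (simp add: fm_nmatrix_def)
qed

text \<open>The operations on formulas are single-valued, but many tuples lie over the same
  \<open>bs\<close>; \<open>wit\<close> says that together they produce all values in
  \<open>M\<close>.\<close>

lemma covering_fm_nmatrix:
  assumes e: "inj_on e (Fm Sg Q)" and v: "valuation Sg Q M v" and "desig M \<subseteq> vals M"
    and surj: "vals M \<subseteq> v ` Fm Sg Q"
    and wit: "\<And>k c bs b. c \<in> Sg k \<Longrightarrow> bs \<in> tuples k (vals M) \<Longrightarrow> b \<in> interp M c bs \<Longrightarrow>
      \<exists>\<phi>s \<in> tuples k (Fm Sg Q). map v \<phi>s = bs \<and> v (Con c \<phi>s) = b"
  shows "covering Sg (v \<circ> inv_into (Fm Sg Q) e) (fm_nmatrix Sg Q e D) M"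
proof -
  let ?d = "inv_into (Fm Sg Q) e" and ?T = "fm_nmatrix Sg Q e D"
  have "v ` Fm Sg Q \<subseteq> vals M"
    using v by (auto simp: valuation_def)
  moreover have d: "?d (e \<phi>) = \<phi>" if "\<phi> \<in> Fm Sg Q" for \<phi>
    using e that by simp
  then have "(v \<circ> ?d) ` vals ?T = v ` Fm Sg Q"
    by (simp add: fm_nmatrix_def image_image)
  ultimately have vals: "(v \<circ> ?d) ` vals ?T = vals M"
    using surj by simp
  have "{(v \<circ> ?d) y | y ys. set ys \<subseteq> vals ?T \<and> map (v \<circ> ?d) ys = bs \<and> y \<in> interp ?T c ys} =
      interp M c bs" (is "?L = _")
    if c: "c \<in> Sg k" and bs: "bs \<in> tuples k (vals M)" for k c bs
  proof
    show "?L \<subseteq> interp M c bs"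
    proof clarify
      fix y ys assume ys: "set ys \<subseteq> vals ?T" "bs = map (v \<circ> ?d) ys" "y \<in> interp ?T c ys"
      have "map ?d ys \<in> tuples k (Fm Sg Q)"
        using ys bs by (auto simp: tuples_def fm_nmatrix_def intro: inv_into_into)
      then show "(v \<circ> ?d) y \<in> interp M c (map (v \<circ> ?d) ys)"
        using ys(3) d[OF Con_in_Fm[of c Sg k _ Q, OF c]] valuation_Con[of Sg Q M v c k, OF v c]
        by (fastforce simp: fm_nmatrix_def)
    qed
    show "interp M c bs \<subseteq> ?L"
    proof
      fix b assume "b \<in> interp M c bs"
      then obtain \<phi>s where \<phi>s: "\<phi>s \<in> tuples k (Fm Sg Q)" "map v \<phi>s = bs" "v (Con c \<phi>s) = b"
        using wit[OF c bs] by blast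
      have "map (?d \<circ> e) \<phi>s = \<phi>s"
        using \<phi>s d by (auto simp: tuples_def subset_iff intro!: map_idI)
      then have "map (v \<circ> ?d) (map e \<phi>s) = bs" "e (Con c \<phi>s) \<in> interp ?T c (map e \<phi>s)"
        using \<phi>s(2) by (auto simp: fm_nmatrix_def comp_assoc simp flip: map_map)
      moreover have "set (map e \<phi>s) \<subseteq> vals ?T" "b = (v \<circ> ?d) (e (Con c \<phi>s))"
        using \<phi>s d[OF Con_in_Fm[of c Sg k _ Q, OF c]] by (auto simp: tuples_def fm_nmatrix_def)
      ultimately show "b \<in> ?L"
        by blast
    qed
  qed
  then show ?thesis
    using vals assms(3) by (auto simp: covering_def same_nmatrix_def image_nmatrix_def)
qed

section \<open>A valuation that covers an Nmatrix\<close>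

text \<open>With a variable \<open>(x, b)\<close> of value \<open>x\<close> for every pair of values, the formula built from \<open>c\<close>
  and the variables \<open>(x\<^sub>1, b), \<dots>, (x\<^sub>k, b)\<close> can be given the value \<open>b\<close>, for every \<open>b\<close> among
  the values of \<open>c\<close> at \<open>x\<^sub>1, \<dots>, x\<^sub>k\<close> simultaneously.  For \<open>k = 0\<close> all these
  formulas coincide, which is where single-valuedness is needed.\<close>

primrec diag_val :: "('s, 'b) nmatrix \<Rightarrow> ('s, 'b \<times> 'b) fm \<Rightarrow> 'b" where
  "diag_val N (Var p) = fst p"
| "diag_val N (Con c \<phi>s) =
     (SOME b. b \<in> interp N c (map (diag_val N) \<phi>s) \<and>
        (\<forall>b' \<in> interp N c (map (diag_val N) \<phi>s).
           \<phi>s = map (\<lambda>x. Var (x, b')) (map (diag_val N) \<phi>s) \<longrightarrow> b = b'))"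

text \<open>The choice made by \<open>diag_val\<close> is satisfiable because the shape of
  \<open>\<phi>s\<close> prescribes at most one value.\<close>

lemma diag_val_Con:
  assumes N: "is_nmatrix Sg N" "Sg 0 = {} \<or> nullary_det Sg N"
    and c: "c \<in> Sg k" "map (diag_val N) \<phi>s \<in> tuples k (vals N)"
  shows "diag_val N (Con c \<phi>s) \<in> interp N c (map (diag_val N) \<phi>s)"
    and "b \<in> interp N c (map (diag_val N) \<phi>s) \<Longrightarrow>
      \<phi>s = map (\<lambda>x. Var (x, b)) (map (diag_val N) \<phi>s) \<Longrightarrow> diag_val N (Con c \<phi>s) = b"
proof -
  let ?bs = "map (diag_val N) \<phi>s"
  let ?B = "interp N c ?bs"
  have "\<exists>b. b \<in> ?B \<and> (\<forall>b' \<in> ?B. \<phi>s = map (\<lambda>x. Var (x, b')) ?bs \<longrightarrow> b = b')"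
  proof (cases "\<exists>b \<in> ?B. \<phi>s = map (\<lambda>x. Var (x, b)) ?bs")
    case True
    then obtain b where b: "b \<in> ?B" "\<phi>s = map (\<lambda>x. Var (x, b)) ?bs"
      by blast
    \<comment> \<open>A nonempty \<open>\<phi>s\<close> displays the prescribed value in its first
      variable; an empty one displays nothing, and single-valuedness decides.\<close>
    have "b = b'" if b': "b' \<in> ?B" "\<phi>s = map (\<lambda>x. Var (x, b')) ?bs" for b'
    proof (cases \<phi>s)
      case Nil
      then have "c \<in> Sg 0" "?B = interp N c []"
        using c by (auto simp: tuples_def)
      then have "is_singleton ?B"
        using N(2) by (auto simp: nullary_det_def)
      then show ?thesis
        using b(1) b'(1) by (metis is_singletonE singletonD)
    next
      case (Cons \<phi> \<psi>s)
      then show ?thesis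
        using b(2) b'(2) by (metis fm.inject(1) list.inject list.simps(9) prod.inject)
    qed
    then show ?thesis
      using b(1) by blast
  next
    case False
    moreover have "?B \<noteq> {}"
      using N(1) c by (auto simp: is_nmatrix_def)
    ultimately show ?thesis
      by blast
  qed
  then have *: "diag_val N (Con c \<phi>s) \<in> ?B \<and>
      (\<forall>b' \<in> ?B. \<phi>s = map (\<lambda>x. Var (x, b')) ?bs \<longrightarrow> diag_val N (Con c \<phi>s) = b')"
    unfolding diag_val.simps by (rule someI_ex)
  then show "diag_val N (Con c \<phi>s) \<in> ?B"
    by (rule conjunct1)
  show "b \<in> ?B \<Longrightarrow> \<phi>s = map (\<lambda>x. Var (x, b)) ?bs \<Longrightarrow> diag_val N (Con c \<phi>s) = b"
    using conjunct2[OF *] by metis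
qed

lemma valuation_diag_val:
  assumes N: "is_nmatrix Sg N" "Sg 0 = {} \<or> nullary_det Sg N"
  shows "valuation Sg (vals N \<times> vals N) N (diag_val N)"
proof -
  have vals: "diag_val N \<phi> \<in> vals N" if "\<phi> \<in> Fm Sg (vals N \<times> vals N)" for \<phi>
    using that
  proof (induction rule: Fm.induct)
    case (Var p)
    then show ?case
      by auto
  next
    case (Con c \<phi>s)
    then have tup: "map (diag_val N) \<phi>s \<in> tuples (length \<phi>s) (vals N)"
      by (auto simp: tuples_def)
    then have "interp N c (map (diag_val N) \<phi>s) \<subseteq> vals N"
      using N(1) Con(1) unfolding is_nmatrix_def by blast
    then show ?case
      using diag_val_Con(1)[OF N Con(1) tup] by (rule subsetD)
  qed
  moreover have "diag_val N (Con c \<phi>s) \<in> interp N c (map (diag_val N) \<phi>s)"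
    if "c \<in> Sg k" "\<phi>s \<in> tuples k (Fm Sg (vals N \<times> vals N))" for c k \<phi>s
    using that vals by (intro diag_val_Con(1)[OF N]) (auto simp: tuples_def)
  ultimately show ?thesis
    by (simp add: valuation_def)
qed

lemma diag_val_covers:
  assumes N: "is_nmatrix Sg N" "Sg 0 = {} \<or> nullary_det Sg N"
    and c: "c \<in> Sg k" "bs \<in> tuples k (vals N)" "b \<in> interp N c bs"
  shows "\<exists>\<phi>s \<in> tuples k (Fm Sg (vals N \<times> vals N)).
    map (diag_val N) \<phi>s = bs \<and> diag_val N (Con c \<phi>s) = b"
proof -
  let ?\<phi>s = "map (\<lambda>x. Var (x, b)) bs"
  have bs: "map (diag_val N) ?\<phi>s = bs"
    by (simp add: comp_def)
  \<comment> \<open>The tag \<open>b\<close> must be a value of \<open>N\<close> for the tagged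
    variables to be available.\<close>
  have "b \<in> vals N"
    using N(1) c unfolding is_nmatrix_def by blast
  then have "?\<phi>s \<in> tuples k (Fm Sg (vals N \<times> vals N))"
    using c(2) by (auto simp: tuples_def intro!: Fm.Var)
  moreover have "diag_val N (Con c ?\<phi>s) = b"
    using diag_val_Con(2)[OF N c(1), of ?\<phi>s b] bs c(2,3) by simp
  ultimately show ?thesis
    using bs by blast
qed

section \<open>Realising a designation pattern in an ultraproduct\<close>

text \<open>Each index codes a finite set of formulas on which its factor realises \<open>D\<close>.
  The ultrafilter is chosen so that every formula belongs to the coded set at almost all
  indices.\<close>

lemma ultraproduct_valuation_exists:
  fixes \<M> :: "('s, 'a) nmatrix set" and Sg :: "nat \<Rightarrow> 's set" and Q :: "'q set"
  assumes card: "Fpow (Fm Sg Q) \<lesssim> (UNIV :: 'i set)"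
    and u: "(UNIV :: ('i \<Rightarrow> 'a) set) \<lesssim> (UNIV :: 'u set)"
    and \<M>: "\<forall>M \<in> \<M>. is_nmatrix Sg M"
    and finite_pattern: "\<And>X. finite X \<Longrightarrow> X \<subseteq> Fm Sg Q \<Longrightarrow>
      \<exists>M \<in> \<M>. \<exists>w. valuation Sg Q M w \<and> (\<forall>\<phi> \<in> X. w \<phi> \<in> desig M \<longleftrightarrow> \<phi> \<in> D)"
  shows "\<exists>M \<in> (UProd TYPE('i) Sg \<M> :: ('s, 'u) nmatrix set).
    \<exists>w. valuation Sg Q M w \<and> (\<forall>\<phi> \<in> Fm Sg Q. w \<phi> \<in> desig M \<longleftrightarrow> \<phi> \<in> D)"
proof -
  obtain g :: "'i \<Rightarrow> ('s, 'q) fm set" where g: "Fpow (Fm Sg Q) \<subseteq> range g"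
    using card by (auto simp: lepoll_iff)
  \<comment> \<open>Indices that code no finite set of formulas get the empty set and carry no
    constraint.\<close>
  define G where "G i = (if g i \<in> Fpow (Fm Sg Q) then g i else {})" for i
  have "\<exists>M w. M \<in> \<M> \<and> valuation Sg Q M w \<and> (\<forall>\<phi> \<in> G i. w \<phi> \<in> desig M \<longleftrightarrow> \<phi> \<in> D)" for i
  proof -
    have "finite (G i)" "G i \<subseteq> Fm Sg Q"
      by (auto simp: G_def Fpow_def)
    then show ?thesis
      using finite_pattern[of "G i"] by blast
  qed
  then obtain F w where F: "\<And>i. F i \<in> \<M>" and w: "\<And>i. valuation Sg Q (F i) (w i)"
    and wD: "\<And>i \<phi>. \<phi> \<in> G i \<Longrightarrow> w i \<phi> \<in> desig (F i) \<longleftrightarrow> \<phi> \<in> D"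
    by metis
  \<comment> \<open>Finitely many formulas form a set \<open>X\<close>, and an index coding
    \<open>X\<close> lies in all the sets concerned.\<close>
  have "\<Inter>K \<noteq> {}" if K: "finite K" "K \<subseteq> (\<lambda>\<phi>. {i. \<phi> \<in> G i}) ` Fm Sg Q" for K
  proof -
    obtain X where X: "X \<subseteq> Fm Sg Q" "finite X" "K = (\<lambda>\<phi>. {i. \<phi> \<in> G i}) ` X"
      using finite_subset_image[OF K] by blast
    then have "X \<in> Fpow (Fm Sg Q)"
      by (simp add: Fpow_def)
    then obtain i where "g i = X"
      using g by auto
    then have "G i = X"
      using \<open>X \<in> Fpow (Fm Sg Q)\<close> by (simp add: G_def)
    then show ?thesis
      using X by auto
  qed
  then obtain U0 where U0: "ultrafilter_on UNIV U0" and G: "(\<lambda>\<phi>. {i. \<phi> \<in> G i}) ` Fm Sg Q \<subseteq> U0"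
    by (rule ultrafilter_on_UNIV_exists)
  \<comment> \<open>Whichever half is large, restricting to it secures the dichotomy required by
    \<open>desig_ultraproduct_iff\<close>.\<close>
  define J where "J =
    (if {i. desig (F i) \<noteq> {}} \<in> U0 then {i. desig (F i) \<noteq> {}} else {i. desig (F i) = {}})"
  have "UNIV - {i. desig (F i) \<noteq> {}} = {i. desig (F i) = {}}"
    by auto
  then have "J \<in> U0"
    using ultrafilter_onD(6)[OF U0, of "{i. desig (F i) \<noteq> {}}"] by (simp add: J_def) blast
  have dichotomy: "(\<forall>i \<in> J. desig (F i) \<noteq> {}) \<or> (\<forall>i \<in> J. desig (F i) = {})"
    by (simp add: J_def)
  define U where "U = {X \<in> U0. X \<subseteq> J}"
  have U: "ultrafilter_on J U"
    unfolding U_def using U0 \<open>J \<in> U0\<close> by (rule ultrafilter_on_restrict)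
  have nm: "\<And>i. is_nmatrix Sg (F i)"
    using F \<M> by blast
  define up where "up = ultraproduct J U F"
  have up: "is_nmatrix Sg up"
    unfolding up_def using U nm by (rule is_nmatrix_ultraproduct)
  define v where "v \<phi> = ultra_eq J U F `` {\<lambda>i\<in>J. w i \<phi>}" for \<phi>
  have v: "valuation Sg Q up v"
    unfolding up_def v_def using U w by (rule valuation_ultraproduct)
  have v_desig: "v \<phi> \<in> desig up \<longleftrightarrow> \<phi> \<in> D" if "\<phi> \<in> Fm Sg Q" for \<phi>
  proof -
    have "(\<lambda>i\<in>J. w i \<phi>) \<in> vals (product J F)"
      using w that by (auto simp: product_def valuation_def)
    then have "v \<phi> \<in> desig up \<longleftrightarrow> {i \<in> J. (\<lambda>i\<in>J. w i \<phi>) i \<in> desig (F i)} \<in> U"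
      unfolding v_def up_def by (rule desig_ultraproduct_iff[OF U nm dichotomy])
    also have "{i \<in> J. (\<lambda>i\<in>J. w i \<phi>) i \<in> desig (F i)} = {i \<in> J. w i \<phi> \<in> desig (F i)}"
      by auto
    also have "\<dots> \<in> U \<longleftrightarrow> \<phi> \<in> D"
    proof -
      have "{i. \<phi> \<in> G i} \<in> U0"
        using G that by blast
      \<comment> \<open>On this large set the designation of \<open>w i \<phi>\<close> is settled by
        \<open>\<phi> \<in> D\<close>; for \<open>\<phi>\<close> outside \<open>D\<close> the
        designating indices are disjoint from it and cannot form a large set.\<close>
      then have S: "{i. \<phi> \<in> G i} \<inter> J \<in> U"
        using ultrafilter_onD(4)[OF U0 _ \<open>J \<in> U0\<close>] by (simp add: U_def)
      show ?thesis
      proof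
        assume "\<phi> \<in> D"
        then show "{i \<in> J. w i \<phi> \<in> desig (F i)} \<in> U"
          by (intro ultrafilter_onD(5)[OF U S]) (auto simp: wD)
      next
        assume "{i \<in> J. w i \<phi> \<in> desig (F i)} \<in> U"
        then have "{i. \<phi> \<in> G i} \<inter> J \<inter> {i \<in> J. w i \<phi> \<in> desig (F i)} \<in> U"
          by (rule ultrafilter_onD(4)[OF U S])
        then have "{i. \<phi> \<in> G i} \<inter> J \<inter> {i \<in> J. w i \<phi> \<in> desig (F i)} \<noteq> {}"
          using ultrafilter_onD(3)[OF U] by metis
        then show "\<phi> \<in> D"
          using wD by blast
      qed
    qed
    finally show ?thesis .
  qed
  \<comment> \<open>The values of the ultraproduct are classes of functions; representatives embed
    them into \<open>'u\<close>.\<close>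
  obtain j :: "('i \<Rightarrow> 'a) \<Rightarrow> 'u" where "inj j"
    using u by (auto simp: lepoll_def)
  then have "inj_on j (vals (product J F))"
    by (rule inj_on_subset) simp
  then obtain \<iota> :: "('i \<Rightarrow> 'a) set \<Rightarrow> 'u" where "inj_on \<iota> (vals (product J F) // ultra_eq J U F)"
    using inj_on_quotient_exists[OF equiv_ultra_eq[OF U]] by blast
  then have "inj_on \<iota> (vals up)"
    by (simp add: up_def ultraproduct_def quot_def)
  then obtain M :: "('s, 'u) nmatrix" where M: "is_nmatrix Sg M" and iso: "is_iso Sg \<iota> up M"
    by (rule isomorphic_copy_exists[OF up])
  have "M \<in> UProd TYPE('i) Sg \<M>"
    using M U F iso unfolding UProd_def isomorphic_def up_def by blast
  moreover have strict: "strict_hom Sg \<iota> up M"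
    using iso by (simp add: is_iso_def)
  ultimately show ?thesis
    using valuation_strict_hom[OF strict v] v_desig by (intro bexI[of _ M] exI[of _ "\<iota> \<circ> v"]) auto
qed

section \<open>Representation of sound Nmatrices\<close>

text \<open>The type bounds meet three needs: \<open>'i\<close> indexes the finite sets of formulas
  over \<open>Q\<close>, \<open>'u\<close> holds the values of the ultraproduct, and
  \<open>'w\<close> codes the formulas.\<close>

lemma Nmatr_in_Hom_s:
  fixes Sg :: "nat \<Rightarrow> 's set" and P :: "'p set"
    and \<M> :: "('s, 'a) nmatrix set" and N :: "('s, 'b) nmatrix"
  assumes "countable (\<Union>k. Sg k)" and "infinite P"
    and \<M>: "\<forall>M \<in> \<M>. is_nmatrix Sg M" and R: "R = entails_class Sg P \<M>"
    and i: "infinite (UNIV :: 'i set)" "(UNIV :: 'b set) \<lesssim> (UNIV :: 'i set)"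
    and u: "(UNIV :: ('i \<Rightarrow> 'a) set) \<lesssim> (UNIV :: 'u set)"
    and w: "infinite (UNIV :: 'w set)" "(UNIV :: 'b set) \<lesssim> (UNIV :: 'w set)"
    and NR: "N \<in> Nmatr Sg P R" and det: "Sg 0 = {} \<or> nullary_det Sg N"
  shows "N \<in> Hom_s Sg P R
    (HomInv_s Sg (SubN Sg (UProd TYPE('i) Sg \<M> :: ('s, 'u) nmatrix set)) :: ('s, 'w) nmatrix set)"
proof -
  have N: "is_nmatrix Sg N" and sound: "sound Sg P R N"
    using NR by (simp_all add: Nmatr_def)
  define Q where "Q = vals N \<times> vals N"
  define v where "v = diag_val N"
  define D where "D = {\<phi> \<in> Fm Sg Q. v \<phi> \<in> desig N}"
  have desig: "desig N \<subseteq> vals N" and "Q \<noteq> {}"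
    using N by (auto simp: is_nmatrix_def Q_def)
  have v: "valuation Sg Q N v"
    unfolding Q_def v_def using N det by (rule valuation_diag_val)
  \<comment> \<open>Kept general in \<open>C\<close> because both the index type and the type of
    formula codes need it.\<close>
  have card: "Fm Sg Q \<lesssim> C" if "infinite C" "(UNIV :: 'b set) \<lesssim> C" for C :: "'c set"
  proof -
    have "vals N \<lesssim> C"
      using that(2) by (rule lepoll_trans[OF subset_imp_lepoll[OF subset_UNIV]])
    then show ?thesis
      unfolding Q_def using assms(1) that(1) by (intro Fm_lepoll_infinite times_lepoll_infinite)
  qed
  have "\<exists>M \<in> (UProd TYPE('i) Sg \<M> :: ('s, 'u) nmatrix set).
      \<exists>z. valuation Sg Q M z \<and> (\<forall>\<phi> \<in> Fm Sg Q. z \<phi> \<in> desig M \<longleftrightarrow> \<phi> \<in> D)"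
  proof (rule ultraproduct_valuation_exists[OF _ u \<M>])
    show "Fpow (Fm Sg Q) \<lesssim> (UNIV :: 'i set)"
      using i(1) card[OF i] by (rule Fpow_lepoll_infinite)
    fix X assume X: "finite X" "X \<subseteq> Fm Sg Q"
    obtain M z where "M \<in> \<M>" "valuation Sg Q M z" "\<And>\<phi>. \<phi> \<in> X \<Longrightarrow> z \<phi> \<in> desig M \<longleftrightarrow> v \<phi> \<in> desig N"
      using refute_finite[OF sound[unfolded R] \<open>infinite P\<close> \<open>Q \<noteq> {}\<close> v X] by blast
    then show "\<exists>M \<in> \<M>. \<exists>z. valuation Sg Q M z \<and> (\<forall>\<phi> \<in> X. z \<phi> \<in> desig M \<longleftrightarrow> \<phi> \<in> D)"
      using X(2) by (intro bexI[of _ M] exI[of _ z]) (auto simp: D_def)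
  qed
  then obtain M :: "('s, 'u) nmatrix" and z where M: "M \<in> UProd TYPE('i) Sg \<M>"
    and z: "valuation Sg Q M z" and zD: "D = {\<phi> \<in> Fm Sg Q. z \<phi> \<in> desig M}"
    by (auto simp: D_def)
  have nmM: "is_nmatrix Sg M"
    using M by (simp add: UProd_def)
  obtain e :: "('s, 'b \<times> 'b) fm \<Rightarrow> 'w" where e: "inj_on e (Fm Sg Q)"
    using card[OF w] by (auto simp: lepoll_def)
  define T where "T = fm_nmatrix Sg Q e D"
  have T: "is_nmatrix Sg T"
    unfolding T_def using \<open>Q \<noteq> {}\<close> by (rule is_nmatrix_fm_nmatrix) (auto simp: D_def)
  define h where "h = z \<circ> inv_into (Fm Sg Q) e"
  have "strict_hom Sg h T M"
    unfolding h_def T_def using e z zD by (rule strict_hom_fm_nmatrix)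
  note h = image_nmatrix_strict_hom[OF T nmM this]
  have nmI: "is_nmatrix Sg (image_nmatrix h T M)"
    using h(1) by (simp add: subnmatrix_def)
  have "image_nmatrix h T M \<in> SubN Sg (UProd TYPE('i) Sg \<M>)"
    unfolding SubN_def using nmI h(1) M isomorphic_refl[OF nmI] by blast
  then have T_in: "T \<in> HomInv_s Sg (SubN Sg (UProd TYPE('i) Sg \<M> :: ('s, 'u) nmatrix set))"
    unfolding HomInv_s_def using T h(2,3) isomorphic_refl[OF T] by blast
  \<comment> \<open>\<open>D\<close> is the pattern of \<open>v\<close> as well as of
    \<open>z\<close>, so the same \<open>T\<close> also maps strictly to \<open>N\<close>.\<close>
  define f where "f = v \<circ> inv_into (Fm Sg Q) e"
  have f: "strict_hom Sg f T N"
    unfolding f_def T_def using e v D_def by (rule strict_hom_fm_nmatrix)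
  have "vals N \<subseteq> v ` Fm Sg Q"
  proof
    fix b assume "b \<in> vals N"
    then have "Var (b, b) \<in> Fm Sg Q" "b = v (Var (b, b))"
      by (auto simp: Q_def v_def intro: Fm.Var)
    then show "b \<in> v ` Fm Sg Q"
      by (rule rev_image_eqI)
  qed
  then have cov: "covering Sg f T N"
    unfolding f_def T_def
    by (rule covering_fm_nmatrix[OF e v desig])
      (unfold Q_def v_def, rule diag_val_covers[OF N det])
  define r where "r = {(x, y). x \<in> vals T \<and> y \<in> vals T \<and> f x = f y}"
  note r = quot_kernel_iso[OF T N f cov, folded r_def]
  then obtain \<kappa> where "is_iso Sg \<kappa> (quot T r) N"
    by (auto simp: isomorphic_def)
  then have "strict_hom Sg \<kappa> (quot T r) N"
    by (simp add: is_iso_def)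
  \<comment> \<open>\<open>Hom_s\<close> demands soundness of the quotient itself, which is
    inherited from \<open>N\<close> along \<open>\<kappa>\<close>.\<close>
  then have "entails Sg P N \<subseteq> entails Sg P (quot T r)"
    by (rule entails_strict_hom)
  then have "sound Sg P R (quot T r)"
    using sound by (auto simp: sound_def)
  then show ?thesis
    unfolding Hom_s_def using N T_in r by blast
qed

text \<open>Classes are sets over fixed types, hence the cardinality bounds. The case distinction on
  \<open>Sg 0\<close> reflects that a multivalued constant of a sound Nmatrix cannot in general be
  recovered from the single formula \<open>Con c []\<close>.\<close>

theorem theorem34:
  fixes Sg :: "nat \<Rightarrow> 's set" and P :: "'p set"
    and \<M> :: "('s, 'a) nmatrix set" and R :: "('s, 'p) conseq"
  assumes "countable (\<Union>k. Sg k)"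
    and "countable P" and "infinite P"
    and "\<forall>M \<in> \<M>. is_nmatrix Sg M"
    and "R = entails_class Sg P \<M>" and "compact_conseq R"
    and "infinite (UNIV :: 'i set)" and "(UNIV :: 'b set) \<lesssim> (UNIV :: 'i set)"
    and "(UNIV :: ('i \<Rightarrow> 'a) set) \<lesssim> (UNIV :: 'u set)"
    and "infinite (UNIV :: 'w set)" and "(UNIV :: 'b set) \<lesssim> (UNIV :: 'w set)"
  shows "let NR = (Nmatr Sg P R :: ('s, 'b) nmatrix set);
             H = (Hom_s Sg P R
                   (HomInv_s Sg
                     (SubN Sg
                       (UProd TYPE('i) Sg \<M> :: ('s, 'u) nmatrix set)) :: ('s, 'w) nmatrix set))
         in (Sg 0 = {} \<longrightarrow> NR = H) \<and>
            H \<subseteq> NR \<and> {N \<in> NR. nullary_det Sg N} \<subseteq> H"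
proof -
  define K where "K =
    (HomInv_s Sg (SubN Sg (UProd TYPE('i) Sg \<M> :: ('s, 'u) nmatrix set)) :: ('s, 'w) nmatrix set)"
  have "(Hom_s Sg P R K :: ('s, 'b) nmatrix set) \<subseteq> Nmatr Sg P R"
    by (rule Hom_s_subset_Nmatr) (simp add: K_def HomInv_s_def)
  \<comment> \<open>The disjunction lets one argument serve both the equality and the restricted
    inclusion.\<close>
  moreover have "N \<in> Hom_s Sg P R K"
    if "N \<in> Nmatr Sg P R" "Sg 0 = {} \<or> nullary_det Sg N" for N :: "('s, 'b) nmatrix"
    unfolding K_def using assms(1,3-5,7-11) that by (rule Nmatr_in_Hom_s)
  ultimately show ?thesis
    unfolding Let_def K_def[symmetric] by blast
qed

end
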